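(* Let $n\ge1$ be an integer and $\alpha>0$. Suppose that $f\in\mathcal{B}_\alpha$ satisfies $\|f\|_\alpha\le K$ for some constant $K\ge1$, $\|f\|_{0,\alpha}=1$ and $\det f'(0)=\lambda\in(0,1]$. Let $m(\lambda)$ be the unique real root of the equation $\varphi(x)=\lambda$ in the interval $[0,a_0]$. Then $f(\mathbb{B}^n)$ contains a schlicht ball of $f$ centered at $f(0)$ of radius $r(0,f)$, where $$r(0,f)\ \ge\ \frac{\lambda K^{1-n}}{m(\lambda)}\int_0^{m(\lambda)}\frac{(1-t^2)^{\alpha(n-1)}(m(\lambda)-t)}{(1-m(\lambda)t)^{\alpha(n+1)+1}}\,dt.$$
   Context: $\mathbb{B}^n=\{z\in\mathbb{C}^n: |z|<1\}$ is the open unit ball for the Euclidean norm $|z|=\big(\sum_{k=1}^n|z_k|^2\big)^{1/2}$. $\mathcal{H}(\mathbb{B}^n)$ is the class of all holomorphic maps $f=(f_1,\ldots,f_n):\mathbb{B}^n\to\mathbb{C}^n$, and $f'(z)=\big(\partial f_i/\partial z_j(z)\big)_{n\times n}$ is the complex Jacobian matrix. For an $n\times n$ complex matrix $A$, $|A|=\sup_{x\ne0}|Ax|/|x|$ is the operator norm. For $\alpha>0$, the $\alpha$-Bloch semi-norm is $$\|f\|_\alpha=\sup_{z\in\mathbb{B}^n}(1-|z|^2)^\alpha|f'(z)|,$$ and the $\alpha$-Bloch space $\mathcal{B}_\alpha$ consists of all $f\in\mathcal{H}(\mathbb{B}^n)$ with $\|f\|_\alpha+|f(0)|<\infty$. Also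 $$\|f\|_{0,\alpha}=\sup_{z\in\mathbb{B}^n}\Big\{(1-|z|^2)^{\frac{\alpha(n+1)}{2n}}\,|\det f'(z)|^{\frac1n}\Big\}.$$ For $x\in[0,1]$, $$\varphi(x)=x(1-x^2)^{\frac{\alpha(n+1)}{2}}\sqrt{\alpha(n+1)+1}\,\left[\frac{\alpha(n+1)+1}{\alpha(n+1)}\right]^{\frac{\alpha(n+1)}{2}},\qquad a_0=\frac{1}{\sqrt{\alpha(n+1)+1}}.$$ The function $\varphi$ is increasing on $[0,a_0]$, decreasing on $[a_0,1]$, with $\varphi(0)=0$ and $\varphi(a_0)=1$, so $m(\lambda)$ is well defined for $\lambda\in(0,1]$. A schlicht ball of $f$ centered at $f(w_1)$, $w_1\in\mathbb{B}^n$, is a ball with center $f(w_1)$ such that $f$ maps an open subset of $\mathbb{B}^n$ containing $w_1$ biholomorphically onto this ball; $r(w_1,f)$ denotes the radius of the largest schlicht ball of $f$ centered at $f(w_1)$. *)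

theory Defs
  imports "HOL-Analysis.Analysis" "HOL-Complex_Analysis.Complex_Analysis"
begin

text \<open>
  \<open>\<complex>\<close>-space of dimension \<open>n\<close> is \<^typ>\<open>complex^'n\<close> with \<open>n = CARD('n)\<close>; its library norm is the
  Euclidean norm, so \<open>ball 0 1\<close> is the open unit ball.
\<close>

text \<open>
  Complex Frechet differentiability: the derivative is required to be given by a complex matrix,
  i.e. to be complex linear and not just real linear.
\<close>

definition holomorphic_map_on ::
    "(complex^'n \<Rightarrow> complex^'m) \<Rightarrow> (complex^'n) set \<Rightarrow> bool" where
  "holomorphic_map_on f U \<longleftrightarrow>
     (\<forall>z\<in>U. \<exists>A :: complex^'n^'m. (f has_derivative (\<lambda>h. A *v h)) (at z))"

definition complex_jacobian :: "(complex^'n \<Rightarrow> complex^'m) \<Rightarrow> complex^'n \<Rightarrow> complex^'n^'m" where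
  "complex_jacobian f z =
     (\<chi> i j. deriv (\<lambda>w. f (\<chi> k. if k = j then w else z $ k) $ i) (z $ j))"

definition matrix_opnorm :: "complex^'n^'m \<Rightarrow> real" where
  "matrix_opnorm A = onorm (\<lambda>x. A *v x)"

text \<open>The two suprema may be infinite, so they are taken in the extended reals.\<close>

definition bloch_seminorm :: "real \<Rightarrow> (complex^'n \<Rightarrow> complex^'n) \<Rightarrow> ereal" where
  "bloch_seminorm \<alpha> f =
     (SUP z\<in>ball 0 1. ereal ((1 - (norm z)\<^sup>2) powr \<alpha> * matrix_opnorm (complex_jacobian f z)))"

definition bloch_space :: "real \<Rightarrow> (complex^'n \<Rightarrow> complex^'n) set" where
  "bloch_space \<alpha> =
     {f. holomorphic_map_on f (ball 0 1) \<and> bloch_seminorm \<alpha> f + ereal (norm (f 0)) < \<infinity>}"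

definition bloch_det_seminorm :: "real \<Rightarrow> (complex^'n \<Rightarrow> complex^'n) \<Rightarrow> ereal" where
  "bloch_det_seminorm \<alpha> f =
     (SUP z\<in>ball 0 1. ereal
        ((1 - (norm z)\<^sup>2) powr (\<alpha> * (real CARD('n) + 1) / (2 * real CARD('n))) *
         cmod (det (complex_jacobian f z)) powr (1 / real CARD('n))))"

definition bloch_phi :: "real \<Rightarrow> nat \<Rightarrow> real \<Rightarrow> real" where
  "bloch_phi \<alpha> n x =
     x * (1 - x\<^sup>2) powr (\<alpha> * (real n + 1) / 2) * sqrt (\<alpha> * (real n + 1) + 1) *
     ((\<alpha> * (real n + 1) + 1) / (\<alpha> * (real n + 1))) powr (\<alpha> * (real n + 1) / 2)"

definition bloch_a0 :: "real \<Rightarrow> nat \<Rightarrow> real" where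
  "bloch_a0 \<alpha> n = 1 / sqrt (\<alpha> * (real n + 1) + 1)"

definition bloch_m :: "real \<Rightarrow> nat \<Rightarrow> real \<Rightarrow> real" where
  "bloch_m \<alpha> n l = (THE x. x \<in> {0..bloch_a0 \<alpha> n} \<and> bloch_phi \<alpha> n x = l)"

definition biholomorphic_onto ::
    "(complex^'n \<Rightarrow> complex^'n) \<Rightarrow> (complex^'n) set \<Rightarrow> (complex^'n) set \<Rightarrow> bool" where
  "biholomorphic_onto f U V \<longleftrightarrow>
     bij_betw f U V \<and> holomorphic_map_on f U \<and> holomorphic_map_on (inv_into U f) V"

definition schlicht_ball :: "(complex^'n \<Rightarrow> complex^'n) \<Rightarrow> complex^'n \<Rightarrow> real \<Rightarrow> bool" where
  "schlicht_ball f w r \<longleftrightarrow>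
     r > 0 \<and>
     (\<exists>U. open U \<and> w \<in> U \<and> U \<subseteq> ball 0 1 \<and> biholomorphic_onto f U (ball (f w) r))"

text \<open>
  For holomorphic \<open>f\<close> with invertible Jacobian at \<open>w\<close> the maximum exists: inverse branches on
  concentric balls agree, and by Liouville the radii are bounded, as the branches take values
  in the unit ball.
\<close>

definition schlicht_radius :: "complex^'n \<Rightarrow> (complex^'n \<Rightarrow> complex^'n) \<Rightarrow> real" where
  "schlicht_radius w f = (GREATEST r. schlicht_ball f w r)"

end

theory Submission
  imports Defs
begin

text \<open>
  On a complex line through the origin, \<open>g \<zeta> = det f'(\<zeta> u)\<close> satisfies
  \<open>\<bar>g \<zeta>\<bar> (1 - \<bar>\<zeta>\<bar>\<^sup>2)\<^sup>b \<le> 1\<close> with \<open>b = \<alpha> (n + 1) / 2\<close>, and \<open>g 0 = \<lambda>\<close>. Comparing \<open>g\<close> with an extremal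
  function through the Schwarz-Pick lemma gives
  \<open>\<bar>det f'(z)\<bar> \<ge> \<lambda> (m - \<bar>z\<bar>) / (m (1 - m \<bar>z\<bar>)\<^sup>2\<^sup>b\<^sup>+\<^sup>1)\<close> for \<open>\<bar>z\<bar> \<le> m\<close>. Hadamard's inequality turns this and
  \<open>\<bar>f'(z)\<bar> \<le> K (1 - \<bar>z\<bar>\<^sup>2)\<^sup>-\<^sup>\<alpha>\<close> into a lower bound for \<open>\<bar>f'(z) h\<bar> / \<bar>h\<bar>\<close>, which is the integrand of the
  theorem up to a constant. Along the inverse image of a segment starting at \<open>f 0\<close> this bounds the
  distance from the origin in terms of the length of the segment, so the inverse branch of \<open>f\<close> can be
  continued as long as that length is less than the integral.
\<close>

text \<open>With b = \<alpha> (n + 1) / 2 the weighted modulus of the extremal function is |\<psi>|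
  (1 - |\<psi>|^2)^b up to a constant. The real function t (1 - t^2)^b has its maximum at a_0, the
  constant in \<phi> makes this maximum 1, and \<phi>(m) = \<lambda> is the value of the extremal
  function at 0. Its zero m is where the lower bound for the determinant runs out, hence the upper
  limit of the integral. Hadamard's inequality is used in the form |det A| |v| <= |A v| |A|^(n-1):
  the n - 1 operator norms produce K^(1-n) and (1 - t^2)^(\<alpha>(n-1)), the determinant all the
  other factors.

  Two facts need work before this can run. Differentiability is assumed pointwise only, so
  continuity of f' and holomorphy of det f' on complex lines are extracted from Cauchy's formula.
  And \<open>schlicht_radius\<close> is a \<open>GREATEST\<close>, about which nothing is known
  until the set of radii is shown to be bounded and to contain its supremum. The continuation of the
  inverse branch then becomes a contradiction with maximality.\<close>

section \<open>Hadamard's inequality\<close>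

text \<open>The Hermitian product. The real inner product of the type is only its real part, and
  real orthogonality of rows would not make a matrix unitary.\<close>

definition cinner :: "complex^'n \<Rightarrow> complex^'n \<Rightarrow> complex" where
  "cinner x y = (\<Sum>k\<in>UNIV. x $ k * cnj (y $ k))"

lemma cinner_self: "cinner x x = of_real ((norm x)\<^sup>2)"
  by (simp add: cinner_def norm_vec_def L2_set_def real_sqrt_pow2 sum_nonneg complex_norm_square del: of_real_power)

lemma cinner_commute: "cinner y x = cnj (cinner x y)"
  by (simp add: cinner_def mult.commute)

lemma cinner_add_left: "cinner (x + y) z = cinner x z + cinner y z"
  and cinner_scale_left: "cinner (c *s x) z = c * cinner x z"
  by (simp_all add: cinner_def algebra_simps sum.distrib sum_distrib_left)

lemma cinner_add_right: "cinner z (x + y) = cinner z x + cinner z y"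
  and cinner_scale_right: "cinner z (c *s x) = cnj c * cinner z x"
  by (simp_all add: cinner_def algebra_simps sum.distrib sum_distrib_left)

lemma norm_vector_smult_complex: "norm (c *s x) = cmod c * norm x" for x :: "complex^'n"
  by (simp add: norm_vec_def L2_set_def norm_mult power_mult_distrib real_sqrt_mult
      flip: sum_distrib_left)

text \<open>Subtracting from \<open>x\<close> its orthogonal projection on \<open>y\<close> lowers
  the squared norm by |\<open>cinner x y\<close>|^2 / |y|^2.\<close>

lemma norm_add_smult_less:
  fixes x y :: "complex^'n"
  assumes "cinner x y \<noteq> 0"
  shows "\<exists>c. norm (x + c *s y) < norm x"
proof -
  define p where "p = cinner x y"
  have "y \<noteq> 0" using assms by (auto simp: cinner_def)
  then have y: "norm y > 0" by simp
  define c where "c = - p / of_real ((norm y)\<^sup>2)"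
  have "of_real ((norm (x + c *s y))\<^sup>2) = cinner (x + c *s y) (x + c *s y)"
    by (simp add: cinner_self)
  also have "\<dots> = of_real ((norm x)\<^sup>2) + cnj c * p + c * cnj p + c * cnj c * of_real ((norm y)\<^sup>2)"
    by (simp add: cinner_add_left cinner_add_right cinner_scale_left cinner_scale_right
        cinner_self[of x] cinner_self[of y] cinner_commute[of y x] p_def algebra_simps del: of_real_power)
  also have "\<dots> = of_real ((norm x)\<^sup>2) - p * cnj p / of_real ((norm y)\<^sup>2)"
    using y by (simp add: c_def field_simps power2_eq_square)
  also have "\<dots> = of_real ((norm x)\<^sup>2 - (cmod p)\<^sup>2 / (norm y)\<^sup>2)"
    by (simp only: of_real_diff of_real_divide complex_norm_square)
  finally have "(norm (x + c *s y))\<^sup>2 = (norm x)\<^sup>2 - (cmod p)\<^sup>2 / (norm y)\<^sup>2"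
    using of_real_eq_iff by blast
  then have "(norm (x + c *s y))\<^sup>2 < (norm x)\<^sup>2"
    using assms y by (simp add: p_def)
  then show ?thesis using power2_less_imp_less[of "norm (x + c *s y)" "norm x"] by auto
qed

lemma det_replace_row_add_multiple:
  fixes X :: "'a::comm_ring_1^'n^'n"
  assumes "i \<noteq> j"
  shows "det (\<chi> k. if k = i then X $ i + c *s X $ j else X $ k) = det X"
  using det_row_operation[OF assms, of X c] by (simp add: row_def vec_nth_inverse cong: if_cong)

lemma det_scale_row:
  fixes X :: "'a::comm_ring_1^'n^'n"
  shows "det (\<chi> k. if k = i then c *s X $ i else X $ k) = c * det X"
proof -
  have "(\<chi> k. if k = i then X $ i else X $ k) = X" by (simp add: vec_eq_iff)
  then show ?thesis using det_row_mul[of i c "\<lambda>_. X $ i" "\<lambda>k. X $ k"] by simp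
qed

lemma continuous_on_det: "continuous_on UNIV (det :: complex^'n^'n \<Rightarrow> complex)"
  unfolding det_def[abs_def] by (intro continuous_intros)

text \<open>
  A matrix maximising the determinant among those with rows in the unit ball, some row possibly
  being prescribed, has orthonormal rows: subtracting from a free row its projection on another row
  does not change the determinant, but would shorten the row and so leave room for rescaling it.
\<close>

lemma unimodular_matrix_maximising_det:
  fixes v :: "complex^'n"
  assumes S: "\<And>i j. i \<in> S \<Longrightarrow> j \<in> S \<Longrightarrow> i = j" and v: "norm v = 1" and vS: "\<And>i. i \<in> S \<Longrightarrow> v $ i \<noteq> 0"
  obtains X :: "complex^'n^'n" where "\<And>j. norm (X $ j) = 1" "\<And>j. j \<in> S \<Longrightarrow> X $ j = v" "cmod (det X) = 1"
    "\<And>Y :: complex^'n^'n. (\<And>j. norm (Y $ j) \<le> 1) \<Longrightarrow> (\<And>j. j \<in> S \<Longrightarrow> Y $ j = v) \<Longrightarrow> cmod (det Y) \<le> 1"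
proof -
  define C where "C = {X :: complex^'n^'n. (\<forall>j. norm (X $ j) \<le> 1) \<and> (\<forall>j\<in>S. X $ j = v)}"
  \<comment> \<open>\<open>E\<close> is a competitor with nonzero determinant, so the maximum is
    positive. With row k prescribed, Cramer's rule gives its determinant as \<open>v $ k\<close>,
    which explains the hypothesis on the entries of \<open>v\<close>.\<close>
  define E :: "complex^'n^'n" where "E = (\<chi> i. if i \<in> S then v else axis i 1)"
  have E: "E \<in> C" by (auto simp: C_def E_def v)
  have "det E \<noteq> 0"
  proof (cases "S = {}")
    case True
    then have "E = mat 1" by (auto simp: E_def mat_def vec_eq_iff axis_def)
    then show ?thesis by simp
  next
    case False
    then obtain k where k: "k \<in> S" by auto
    with S have "S = {k}" by blast
    have r: "row i (mat 1 :: complex^'n^'n) = axis i 1" for i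
      by (auto simp: row_def mat_def vec_eq_iff axis_def)
    have "E = (\<chi> i. if i = k then \<Sum>i\<in>UNIV. v $ i *s row i (mat 1) else row i (mat 1))"
      unfolding r basis_expansion by (simp add: E_def \<open>S = {k}\<close>)
    then have "det E = v $ k * det (mat 1 :: complex^'n^'n)" by (simp only: cramer_lemma_transpose)
    then show ?thesis using vS[OF k] by simp
  qed
  have "closed C" unfolding C_def
    unfolding Ball_def
    by (intro closed_Collect_conj closed_Collect_all closed_Collect_le closed_Collect_imp open_Collect_const
        closed_Collect_eq continuous_intros)
  moreover have "bounded C"
  proof (rule boundedI)
    fix X assume "X \<in> C"
    have "norm X \<le> (\<Sum>j\<in>UNIV. norm (X $ j))" by (simp add: norm_vec_def L2_set_le_sum)
    also have "\<dots> \<le> (\<Sum>j\<in>(UNIV::'n set). 1)" using \<open>X \<in> C\<close> by (intro sum_mono) (auto simp: C_def)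
    finally show "norm X \<le> real CARD('n)" by simp
  qed
  ultimately have "compact C" by (simp add: compact_eq_bounded_closed)
  then obtain X where X: "X \<in> C" and max: "\<And>Y. Y \<in> C \<Longrightarrow> cmod (det Y) \<le> cmod (det X)"
    using continuous_attains_sup[of C "\<lambda>X. cmod (det X)"] E
      continuous_on_norm[OF continuous_on_subset[OF continuous_on_det]] by blast
  have nz: "det X \<noteq> 0" using max[OF E] \<open>det E \<noteq> 0\<close> by auto
  have row_nz: "X $ j \<noteq> 0" for j
    using nz det_zero_row(1)[of j X] by (auto simp: row_def vec_eq_iff)
  have no_shorter: False if j: "j \<notin> S" and Y: "Y = (\<chi> k. if k = j then x else X $ k)"
    and d: "cmod (det Y) = cmod (det X)" and x: "norm x < 1" for j x Y
  proof -
    have xnz: "x \<noteq> 0"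
    proof
      assume "x = 0"
      then have "row j Y = 0" by (simp add: row_def vec_eq_iff Y)
      then have "det Y = 0" by (rule det_zero_row)
      with d nz show False by simp
    qed
    define c where "c = complex_of_real (1 / norm x)"
    define Z where "Z = (\<chi> k. if k = j then c *s Y $ j else Y $ k)"
    have "Z \<in> C" using X j xnz
      by (auto simp: C_def Z_def Y norm_vector_smult_complex c_def norm_divide)
    have "cmod (det Z) = cmod c * cmod (det X)"
      unfolding Z_def det_scale_row norm_mult d ..
    moreover have "cmod c > 1" using x xnz by (simp add: c_def norm_divide)
    ultimately have "cmod (det Z) > cmod (det X)" using nz by simp
    with max[OF \<open>Z \<in> C\<close>] show False by simp
  qed
  have n1: "norm (X $ j) = 1" for j
  proof (cases "j \<in> S")
    case True then show ?thesis using X v by (auto simp: C_def)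
  next
    case False
    have "X = (\<chi> k. if k = j then X $ j else X $ k)" by (simp add: vec_eq_iff)
    from no_shorter[OF False this] have "\<not> norm (X $ j) < 1" by auto
    moreover have "norm (X $ j) \<le> 1" using X by (auto simp: C_def)
    ultimately show ?thesis by simp
  qed
  \<comment> \<open>Only a free row may be altered. As \<open>S\<close> has at most one element, one
    of two distinct rows is always free, and conjugate symmetry covers the other order.\<close>
  have orth': "cinner (X $ i) (X $ j) = 0" if "i \<noteq> j" "i \<notin> S" for i j
  proof (rule ccontr)
    assume "cinner (X $ i) (X $ j) \<noteq> 0"
    from norm_add_smult_less[OF this] obtain c where c: "norm (X $ i + c *s X $ j) < 1"
      by (auto simp: n1)
    show False
      by (rule no_shorter[OF \<open>i \<notin> S\<close> refl _ c]) (simp add: det_replace_row_add_multiple[OF \<open>i \<noteq> j\<close>])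
  qed
  have orth: "cinner (X $ i) (X $ j) = (if i = j then 1 else 0)" for i j
    using orth'[of i j] orth'[of j i] S[of i j] cinner_commute[of "X $ i" "X $ j"]
    by (auto simp: cinner_self n1)
  \<comment> \<open>The conjugate transpose: \<open>X ** X' = mat 1\<close> forces |det X| =
    1.\<close>
  define X' :: "complex^'n^'n" where "X' = (\<chi> i j. cnj (X $ j $ i))"
  have "X ** X' = mat 1"
    using orth by (auto simp: vec_eq_iff matrix_matrix_mult_def X'_def mat_def cinner_def)
  then have "det X * det X' = 1" by (metis det_mul det_I)
  moreover have "det X' = cnj (det X)"
  proof -
    have "det X' = det (transpose X')" by simp
    also have "\<dots> = cnj (det X)"
      by (simp add: det_def X'_def transpose_def cnj_sum cnj_prod)
    finally show ?thesis .
  qed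
  ultimately have "of_real ((cmod (det X))\<^sup>2) = (1::complex)" by (simp only: complex_norm_square)
  then have "(cmod (det X))\<^sup>2 = 1" by (metis of_real_eq_1_iff)
  then have d1: "cmod (det X) = 1" by (simp add: power2_eq_1_iff) (smt (verit) norm_ge_zero)
  show ?thesis
    using that[of X] n1 X d1 max by (auto simp: C_def)
qed

text \<open>After normalising the rows this is the maximality statement with no row prescribed,
  where the maximum of |det| is 1.\<close>

lemma hadamard_det_bound:
  fixes Y :: "complex^'n^'n"
  shows "cmod (det Y) \<le> (\<Prod>i\<in>UNIV. norm (Y $ i))"
proof (cases "\<exists>i. Y $ i = 0")
  case True
  then obtain i where i: "Y $ i = 0" by auto
  then have "det Y = 0" using det_zero_row(1)[of i Y] by (simp add: row_def vec_eq_iff)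
  then show ?thesis by (simp add: prod_nonneg)
next
  case False
  define Z where "Z = (\<chi> i. of_real (1 / norm (Y $ i)) *s Y $ i)"
  have Z: "norm (Z $ i) = 1" for i using False by (simp add: Z_def norm_vector_smult_complex norm_divide)
  obtain v :: "complex^'n" where v: "norm v = 1" using Z by blast
  have "cmod (det Z) \<le> 1"
    by (rule unimodular_matrix_maximising_det[of "{}" v]) (use v Z in auto)
  moreover have "det Z = (\<Prod>i\<in>UNIV. of_real (1 / norm (Y $ i))) * det Y"
    unfolding Z_def by (simp only: det_rows_mul vec_lambda_eta)
  ultimately have "(\<Prod>i\<in>UNIV. 1 / norm (Y $ i)) * cmod (det Y) \<le> 1"
    by (simp add: norm_mult prod_norm[symmetric] norm_divide)
  moreover have "(\<Prod>i\<in>UNIV. norm (Y $ i)) > 0" using False by (intro prod_pos) auto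
  ultimately show ?thesis by (simp add: prod_dividef field_simps)
qed

lemma bounded_linear_matrix_vector_mult_complex:
  "bounded_linear (\<lambda>x. A *v x)" for A :: "complex^'n^'m"
  by (intro linear_conv_bounded_linear[THEN iffD1] linearI)
    (simp_all add: vec_eq_iff matrix_vector_mult_def sum.distrib algebra_simps scaleR_sum_right)

lemma matrix_opnorm_bound: "norm (A *v x) \<le> matrix_opnorm A * norm x"
  unfolding matrix_opnorm_def by (intro onorm bounded_linear_matrix_vector_mult_complex)

lemma matrix_opnorm_nonneg: "matrix_opnorm A \<ge> 0"
  unfolding matrix_opnorm_def by (intro onorm_pos_le bounded_linear_matrix_vector_mult_complex)

text \<open>
  Apply Hadamard's inequality to the images under \<open>A\<close> of an orthonormal basis containing \<open>v\<close>.
\<close>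

lemma det_le_norm_mult_opnorm_power:
  fixes A :: "complex^'n^'n"
  shows "cmod (det A) * norm v \<le> norm (A *v v) * matrix_opnorm A ^ (CARD('n) - 1)"
proof -
  have *: "cmod (det A) \<le> norm (A *v v) * matrix_opnorm A ^ (CARD('n) - 1)" if v: "norm v = 1" for v
  proof -
    have "v \<noteq> 0" using v by auto
    \<comment> \<open>A nonzero coordinate of \<open>v\<close> is a position at which
      \<open>v\<close> may be prescribed as a row.\<close>
    then obtain k where k: "v $ k \<noteq> 0" by (auto simp: vec_eq_iff)
    obtain X :: "complex^'n^'n" where X: "\<And>j. norm (X $ j) = 1" "X $ k = v" "cmod (det X) = 1"
      by (rule unimodular_matrix_maximising_det[of "{k}" v]) (use v k in auto)
    \<comment> \<open>The rows of \<open>Y\<close> are the images of the rows of \<open>X\<close>,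
      and |det X| = 1 makes |det Y| = |det A|. One row is \<open>A *v v\<close>; each of the other n
      - 1 has norm at most the operator norm.\<close>
    define Y where "Y = X ** transpose A"
    have Yi: "Y $ i = A *v (X $ i)" for i
      by (simp add: Y_def matrix_matrix_mult_def matrix_vector_mult_def transpose_def vec_eq_iff mult.commute)
    have "cmod (det A) = cmod (det Y)" by (simp add: Y_def det_mul norm_mult X)
    also have "\<dots> \<le> (\<Prod>i\<in>UNIV. norm (Y $ i))" by (rule hadamard_det_bound)
    also have "\<dots> = norm (A *v v) * (\<Prod>i\<in>UNIV - {k}. norm (Y $ i))"
      by (subst prod.remove[of _ k]) (auto simp: Yi X)
    also have "\<dots> \<le> norm (A *v v) * (\<Prod>i\<in>UNIV - {k}. matrix_opnorm A)"
      using matrix_opnorm_bound[of A "X $ i" for i]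
      by (intro mult_left_mono prod_mono) (auto simp: Yi X)
    finally show ?thesis by (simp add: card_Diff_singleton)
  qed
  show ?thesis
  proof (cases "v = 0")
    case False
    define u where "u = of_real (1 / norm v) *s v"
    have "A *v u = of_real (1 / norm v) *s (A *v v)"
      unfolding u_def by (simp add: vector_scalar_commute)
    then show ?thesis using *[of u] False
      by (simp add: u_def norm_vector_smult_complex norm_divide field_simps)
  qed simp
qed

section \<open>Holomorphic functions on the disc with a weighted bound\<close>

text \<open>By Schwarz-Pick, Q(s) lies in the closed pseudohyperbolic disc about the fixed point p
  whose boundary passes through s. Since 0 <= s <= p, the point of this disc nearest to 0 is s
  itself.\<close>

lemma Schwarz_Pick_real_fixed_point:
  fixes Q :: "complex \<Rightarrow> complex" and p s :: real
  assumes hol: "Q holomorphic_on ball 0 1" and lt: "\<And>w. norm w < 1 \<Longrightarrow> norm (Q w) < 1"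
    and fp: "Q (of_real p) = of_real p" and s: "0 \<le> s" "s \<le> p" "p < 1"
  shows "s \<le> norm (Q (of_real s))"
proof -
  \<comment> \<open>\<open>M\<close> moves p to 0 and \<open>N\<close> is its inverse, so that
    Schwarz's lemma applies to the conjugate of \<open>Q\<close>.\<close>
  define M where "M = (\<lambda>z::complex. (z - of_real p) / (1 - of_real p * z))"
  define N where "N = (\<lambda>z::complex. (z + of_real p) / (1 + of_real p * z))"
  have M: "M = Moebius_function 0 (of_real p)" and N: "N = Moebius_function 0 (- of_real p)"
    by (auto simp: M_def N_def Moebius_function_simple)
  have p: "norm (complex_of_real p) < 1" using s by simp
  have "M \<circ> Q \<circ> N holomorphic_on ball 0 1"
  proof (intro holomorphic_on_compose_gen[of _ _ _ "ball 0 1"])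
    show "N holomorphic_on ball 0 1" "M holomorphic_on ball 0 1" unfolding M N
      by (rule Moebius_function_holomorphic; use p in simp)+
    show "N ` ball 0 1 \<subseteq> ball 0 1" unfolding N
      using Moebius_function_norm_lt_1[of "- of_real p"] p by auto
    show "Q ` ball 0 1 \<subseteq> ball 0 1" using lt by auto
  qed (use hol in auto)
  moreover have "(M \<circ> Q \<circ> N) 0 = 0" by (simp add: N_def fp M_def)
  moreover have "norm ((M \<circ> Q \<circ> N) z) < 1" if "norm z < 1" for z
    using that p lt Moebius_function_norm_lt_1 by (simp add: M N)
  ultimately have SL: "norm ((M \<circ> Q \<circ> N) z) \<le> norm z" if "norm z < 1" for z
    using that by (rule Schwarz_Lemma(1))
  \<comment> \<open>The pseudohyperbolic distance of s and p: \<open>N\<close> sends -t to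
    s.\<close>
  define t where "t = (p - s) / (1 - p * s)"
  have ps: "p * s < 1" using s mult_le_one[of p s] by (smt (verit) mult_left_le)
  have pp: "p * p < 1" using s by (smt (verit) mult_left_le)
  have t0: "0 \<le> t" using s ps by (simp add: t_def)
  have "p - s < 1 - p * s" using s mult_strict_right_mono[of p 1 "1 + s"] 
    by (smt (verit) mult_left_le mult_right_le_one_le ring_class.ring_distribs(1) mult_cancel_left1)
  then have t1: "t < 1" using ps by (simp add: t_def)
  have "1 - p * t = (1 - p * p) / (1 - p * s)" using ps by (simp add: t_def field_simps)
  moreover have "p - t = s * (1 - p * p) / (1 - p * s)" using ps by (simp add: t_def field_simps)
  ultimately have "(p - t) / (1 - p * t) = s" using ps pp by simp
  moreover have "N (of_real (- t)) = of_real ((p - t) / (1 - p * t))" by (simp add: N_def)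
  ultimately have "N (of_real (- t)) = of_real s" by simp
  then have Mt: "norm (M (Q (of_real s))) \<le> t"
    using SL[of "of_real (- t)"] t0 t1 by simp
  define q where "q = Q (of_real s)"
  define c where "c = norm q"
  have c: "0 \<le> c" "c < 1" using lt[of "of_real s"] s by (auto simp: c_def q_def)
  have pc: "p * c < 1" using s c by (smt (verit) mult_left_le mult_nonneg_nonneg)
  have R: "Re q \<le> c" by (simp add: c_def complex_Re_le_cmod)
  have n1: "(norm (q - of_real p))\<^sup>2 = c\<^sup>2 + p\<^sup>2 - 2 * p * Re q"
    unfolding c_def cmod_power2 by (simp add: power2_eq_square algebra_simps)
  have n2: "(norm (1 - of_real p * q))\<^sup>2 = 1 + p\<^sup>2 * c\<^sup>2 - 2 * p * Re q"
    unfolding c_def cmod_power2 by (simp add: power2_eq_square algebra_simps)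
  have nz: "1 - of_real p * q \<noteq> 0"
  proof
    assume "1 - of_real p * q = 0"
    then have "norm (of_real p * q) = 1" by simp
    then show False using pc s by (simp add: norm_mult c_def)
  qed
  have "norm (q - of_real p) \<le> t * norm (1 - of_real p * q)"
    using Mt nz by (simp add: M_def q_def norm_divide field_simps)
  then have "(norm (q - of_real p))\<^sup>2 \<le> t\<^sup>2 * (norm (1 - of_real p * q))\<^sup>2"
    using power_mono[of "norm (q - of_real p)" "t * norm (1 - of_real p * q)" 2] by (simp add: power_mult_distrib)
  then have 1: "c\<^sup>2 + p\<^sup>2 - 2 * p * Re q \<le> t\<^sup>2 * (1 + p\<^sup>2 * c\<^sup>2 - 2 * p * Re q)"
    by (simp add: n1 n2)
  \<comment> \<open>Rotating q onto the positive axis moves it closer to p: replacing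
    \<open>Re q\<close> by c = |q| in 1 lowers the left side by 2 p (c - Re q), the right side only
    by t^2 < 1 times that.\<close>
  have "(1 - t\<^sup>2) * (2 * p * c - 2 * p * Re q) \<ge> 0"
    using t0 t1 R s by (intro mult_nonneg_nonneg) (auto simp: power_le_one mult_left_mono)
  with 1 have "c\<^sup>2 + p\<^sup>2 - 2 * p * c \<le> t\<^sup>2 * (1 + p\<^sup>2 * c\<^sup>2 - 2 * p * c)"
    by (simp add: algebra_simps)
  then have "(p - c)\<^sup>2 \<le> (t * (1 - p * c))\<^sup>2"
    by (simp add: power2_eq_square algebra_simps)
  then have "p - c \<le> t * (1 - p * c)"
    by (rule power2_le_imp_le) (use t0 pc in simp)
  then have "(p - c) * (1 - p * s) \<le> (p - s) * (1 - p * c)"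
    using ps by (simp add: t_def field_simps)
  then have "(1 - p * p) * s \<le> (1 - p * p) * c" by (simp add: algebra_simps)
  then show ?thesis using pp by (simp add: c_def q_def)
qed

text \<open>With \<psi>(u) = (m - u) / (1 - m u) the right side is (1 - |u|^2) |\<psi>'(u)|, so
  composing with \<psi> turns the weight (1 - |z|^2)^b into itself times |\<psi>'|^b.\<close>

lemma one_minus_norm_Moebius:
  fixes m :: real and u :: complex
  assumes "1 - of_real m * u \<noteq> 0"
  shows "1 - (norm ((of_real m - u) / (1 - of_real m * u)))\<^sup>2 =
    (1 - m\<^sup>2) * (1 - (norm u)\<^sup>2) / (norm (1 - of_real m * u))\<^sup>2"
proof -
  have "(norm (1 - of_real m * u))\<^sup>2 - (norm (of_real m - u))\<^sup>2 = (1 - m\<^sup>2) * (1 - (norm u)\<^sup>2)"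
    unfolding cmod_power2 by (simp add: power2_eq_square algebra_simps)
  then show ?thesis using assms by (simp add: norm_divide power_divide field_simps)
qed

text \<open>
  The extremal function is a multiple of \<open>\<psi> (-\<psi>')\<^sup>b\<close> for the disc automorphism \<open>\<psi>\<close> exchanging \<open>0\<close> and
  \<open>m\<close>. Dividing \<open>g\<close> by the factor \<open>(-\<psi>')\<^sup>b\<close>, normalising, and using \<open>w = \<psi>/a\<close> as variable gives the
  self-map \<open>Q\<close> of the disc below, which fixes \<open>m/a\<close>.
\<close>

lemma weighted_growth_lower_bound_strict:
  fixes g :: "complex \<Rightarrow> complex" and a b l m r :: real
  assumes hol: "g holomorphic_on ball 0 1"
    and bd: "\<And>z. norm z < 1 \<Longrightarrow> norm (g z) * (1 - (norm z)\<^sup>2) powr b \<le> 1"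
    and b: "b > 0" and a: "0 < a" "a < 1" and m: "0 < m" "m < a"
    and l: "g 0 = of_real l" "l * (a * (1 - a\<^sup>2) powr b) = m * (1 - m\<^sup>2) powr b"
    and r: "0 \<le> r" "r \<le> m"
  shows "l / m * (m - r) / (1 - m * r) powr (2 * b + 1) \<le> norm (g (of_real r))"
proof -
  define \<psi> where "\<psi> = (\<lambda>u::complex. (of_real m - u) / (1 - of_real m * u))"
  define P where "P = (1 - m\<^sup>2) powr b"
  define A where "A = (1 - a\<^sup>2) powr b"
  \<comment> \<open>\<open>P\<close> times the complex power is (-\<psi>'(u))^b at u = a w; as
    \<psi> is an involution, multiplying by it amounts to dividing by the same factor at \<psi>(u).
    The scale a makes the bound for \<open>Q\<close> strict, since (1 - |u|^2)^b > \<open>A\<close>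
    for |u| < a.\<close>
  define Q where "Q = (\<lambda>w. g (\<psi> (of_real a * w)) * of_real (P * A) * (1 - of_real m * (of_real a * w)) powr of_real (- 2 * b))"
  have m2: "m\<^sup>2 < 1" and a2: "a\<^sup>2 < 1" using m a by (auto simp: power_less_one_iff)
  have pos: "P > 0" "A > 0" using m2 a2 by (auto simp: P_def A_def)
  have mu: "norm (of_real m * u) < 1" if "norm u < 1" for u :: complex
    using that m a mult_strict_mono[of m 1 "norm u" 1] by (simp add: norm_mult)
  \<comment> \<open>A positive real part keeps 1 - m u off the branch cut of the complex
    power.\<close>
  have Re: "Re (1 - of_real m * u) > 0" if "norm u < 1" for u :: complex
    using complex_Re_le_cmod[of "of_real m * u"] mu[OF that] by simp
  have nz: "1 - of_real m * u \<noteq> 0" if "norm u < 1" for u :: complex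
    using Re[OF that] by force
  have \<psi>1: "norm (\<psi> u) < 1" if "norm u < 1" for u
  proof -
    have "1 - (norm (\<psi> u))\<^sup>2 > 0" unfolding \<psi>_def one_minus_norm_Moebius[OF nz[OF that]]
      using m2 that nz[OF that] by (intro divide_pos_pos mult_pos_pos) (auto simp: power_less_one_iff)
    then show ?thesis by (simp add: power_less_one_iff)
  qed
  have aw: "norm (of_real a * w) < 1" if "norm w < 1" for w :: complex
    using that a mult_strict_mono[of a 1 "norm w" 1] by (simp add: norm_mult)
  have norm_Q: "norm (Q w) = norm (g (\<psi> (of_real a * w))) * P * A * norm (1 - of_real m * (of_real a * w)) powr (- 2 * b)"
    if "norm w < 1" for w
    using pos nz[OF aw[OF that]] by (simp add: Q_def norm_mult norm_powr_real_powr')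
  have "Q holomorphic_on ball 0 1"
  proof -
    have "g \<circ> (\<lambda>w. \<psi> (of_real a * w)) holomorphic_on ball 0 1"
    proof (rule holomorphic_on_compose_gen[OF _ hol])
      show "(\<lambda>w. \<psi> (of_real a * w)) holomorphic_on ball 0 1" unfolding \<psi>_def
        using nz[OF aw] by (intro holomorphic_intros) auto
    qed (use \<psi>1 aw in auto)
    moreover have "(\<lambda>w. 1 - of_real m * (of_real a * w) :: complex) \<in> ball 0 1 \<rightarrow> - \<real>\<^sub>\<le>\<^sub>0"
      using Re[OF aw] by (force simp: complex_nonpos_Reals_iff)
    ultimately show ?thesis unfolding Q_def o_def
      by (intro holomorphic_intros) auto
  qed
  moreover have "norm (Q w) < 1" if w: "norm w < 1" for w
  proof -
    define u where "u = of_real a * w"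
    have u: "norm u < 1" "norm u < a" using aw[OF w] w a by (auto simp: u_def norm_mult)
    define D where "D = norm (1 - of_real m * u)"
    have D: "D > 0" using nz[OF u(1)] by (simp add: D_def)
    have u2: "(norm u)\<^sup>2 < a\<^sup>2" using u by (intro power_strict_mono) auto
    define U where "U = (1 - (norm u)\<^sup>2) powr b"
    have "A < U" using u2 a2 b by (simp add: A_def U_def powr_less_mono2)
    have "(1 - (norm (\<psi> u))\<^sup>2) powr b = ((1 - m\<^sup>2) * (1 - (norm u)\<^sup>2) / D\<^sup>2) powr b"
      unfolding \<psi>_def D_def one_minus_norm_Moebius[OF nz[OF u(1)]] ..
    also have "\<dots> = P * U * (D powr (- 2 * b))"
    proof -
      have "D\<^sup>2 powr b = D powr (2 * b)" using D by (simp add: powr_powr flip: powr_numeral)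
      then show ?thesis using m2 u2 a2 D
        by (simp add: P_def U_def powr_mult powr_divide powr_minus_divide)
    qed
    finally have "norm (g (\<psi> u)) * (P * U * D powr (- 2 * b)) \<le> 1"
      using bd[OF \<psi>1[OF u(1)]] by simp
    moreover have "norm (Q w) = norm (g (\<psi> u)) * P * A * D powr (- 2 * b)"
      unfolding norm_Q[OF w] u_def D_def ..
    ultimately have "(norm (Q w) / A) * U \<le> 1" using pos by (simp add: mult_ac)
    then have "norm (Q w) * U \<le> A" using pos by (simp add: field_simps)
    then have "norm (Q w) * U < 1 * U" using \<open>A < U\<close> by simp
    then show ?thesis using \<open>A < U\<close> pos by (auto simp: mult_less_cancel_right_disj)
  qed
  \<comment> \<open>\<psi> sends m to 0, so only g(0) = l enters; the equation relating l, a and m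
    turns the value l \<open>A\<close> / \<open>P\<close> into m/a.\<close>
  moreover have "Q (of_real (m / a)) = of_real (m / a)"
  proof -
    have "Q (of_real (m / a)) = of_real l * of_real (P * A) * of_real (1 - m * m) powr of_real (- 2 * b)"
      using a by (simp add: Q_def \<psi>_def l)
    also have "\<dots> = of_real (l * (P * A) * (1 - m * m) powr (- 2 * b))"
    proof -
      have "complex_of_real (1 - m * m) powr of_real (- 2 * b) = of_real ((1 - m * m) powr (- 2 * b))"
        using m2 by (intro powr_of_real) (simp add: power2_eq_square)
      then show ?thesis by (simp only: of_real_mult)
    qed
    also have "(1 - m * m) powr (- 2 * b) = 1 / (P * P)"
      using m2 by (simp add: P_def powr_minus power2_eq_square field_simps flip: powr_add)
    also have "l * (P * A) * (1 / (P * P)) = m / a"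
      using l(2) a pos by (simp add: P_def[symmetric] A_def[symmetric] field_simps)
    finally show ?thesis .
  qed
  \<comment> \<open>\<open>s\<close> is \<psi>(r), hence \<psi>(s) = r, and s <= m because r >= 0.
    Evaluating \<open>Q\<close> at s/a therefore reads off g(r).\<close>
  moreover define s where "s = (m - r) / (1 - m * r)"
  have "m * r \<le> m * m" using r m by (intro mult_left_mono) auto
  then have mr: "m * r < 1" using m2 by (simp add: power2_eq_square)
  have s0: "0 \<le> s / a" using r mr a by (simp add: s_def)
  moreover have "m * (m * r) \<le> 1 * r" using m2 r mult_right_mono[of "m*m" 1 r] by (auto simp: power2_eq_square mult.assoc)
  then have s1: "s / a \<le> m / a" using mr a m by (intro divide_right_mono) (auto simp: s_def field_simps)
  moreover have "m / a < 1" using m by simp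
  ultimately have main: "s / a \<le> norm (Q (of_real (s / a)))"
    by (intro Schwarz_Pick_real_fixed_point)
  have ms: "1 - m * s = (1 - m * m) / (1 - m * r)" using mr by (simp add: s_def field_simps)
  moreover have "m - s = r * (1 - m * m) / (1 - m * r)" using mr by (simp add: s_def field_simps)
  ultimately have "(m - s) / (1 - m * s) = r" using mr m2 by (simp add: power2_eq_square)
  moreover have "\<psi> (of_real s) = of_real ((m - s) / (1 - m * s))" by (simp add: \<psi>_def)
  ultimately have \<psi>s: "\<psi> (of_real s) = of_real r" by simp
  define R where "R = (1 - m * r) powr (2 * b)"
  have R: "R > 0" using mr by (simp add: R_def)
  have "norm (1 - of_real m * complex_of_real s) = (1 - m * m) / (1 - m * r)"
  proof -
    have "norm (1 - of_real m * complex_of_real s) = norm (complex_of_real (1 - m * s))" by simp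
    also have "\<dots> = (1 - m * m) / (1 - m * r)" unfolding norm_of_real ms
      using mr m2 by (simp add: power2_eq_square)
    finally show ?thesis .
  qed
  then have "norm (1 - of_real m * complex_of_real s) powr (- 2 * b) = ((1 - m * m) / (1 - m * r)) powr (- 2 * b)"
    by (simp only:)
  also have "\<dots> = R / (P * P)"
  proof -
    have "(1 - m * m) powr (2 * b) = P * P" by (simp add: P_def power2_eq_square flip: powr_add)
    then show ?thesis using m2 mr by (simp add: powr_divide R_def powr_minus_divide power2_eq_square)
  qed
  finally have "norm (1 - of_real m * complex_of_real s) powr (- 2 * b) = R / (P * P)" .
  moreover have "s / a < 1" using s1 \<open>m / a < 1\<close> by simp
  then have "norm (complex_of_real (s / a)) < 1" unfolding norm_of_real using s0 by simp
  ultimately have "s / a \<le> norm (g (of_real r)) * P * A * (R / (P * P))"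
    using main norm_Q[of "of_real (s/a)"] a \<psi>s by simp
  then have "s * P / (a * A * R) \<le> norm (g (of_real r))"
    using a pos R by (simp add: field_simps)
  moreover have "P = l / m * a * A" using l(2) m by (simp add: P_def A_def field_simps)
  ultimately have "s * (l / m) / R \<le> norm (g (of_real r))" using a pos by simp
  moreover have "s * (l / m) / R = l / m * (m - r) / (1 - m * r) powr (2 * b + 1)"
    using mr by (simp add: s_def R_def powr_add mult_ac)
  ultimately show ?thesis by simp
qed

text \<open>
  The boundary case \<open>m = a\<close>, where the fixed point \<open>m/a\<close> leaves the disc, is reached by applying the
  strict case to \<open>\<theta> x \<cdot> g\<close> with \<open>x < m\<close> and letting \<open>x\<close> tend to \<open>m\<close>.
\<close>

lemma weighted_growth_lower_bound:
  fixes g :: "complex \<Rightarrow> complex" and a b l m r :: real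
  assumes hol: "g holomorphic_on ball 0 1"
    and bd: "\<And>z. norm z < 1 \<Longrightarrow> norm (g z) * (1 - (norm z)\<^sup>2) powr b \<le> 1"
    and b: "b > 0" and a: "0 < a" "a < 1" and m: "0 < m" "m \<le> a"
    and mono: "\<And>x. 0 < x \<Longrightarrow> x \<le> m \<Longrightarrow> x * (1 - x\<^sup>2) powr b \<le> m * (1 - m\<^sup>2) powr b"
    and l: "g 0 = of_real l" "l * (a * (1 - a\<^sup>2) powr b) = m * (1 - m\<^sup>2) powr b"
    and r: "0 \<le> r" "r \<le> m"
  shows "l / m * (m - r) / (1 - m * r) powr (2 * b + 1) \<le> norm (g (of_real r))"
\<comment> \<open>For r = m the left side is 0; otherwise there is room for r < x < m.\<close>
proof (cases "r = m")
  case False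
  then have rm: "r < m" using r by simp
  have m2: "m\<^sup>2 < 1" using m a by (simp add: power_less_one_iff)
  have "m * r \<le> m * m" using r m by (intro mult_left_mono) auto
  then have mr: "m * r < 1" using m2 by (simp add: power2_eq_square)
  define \<phi> where "\<phi> = (\<lambda>x::real. x * (1 - x\<^sup>2) powr b)"
  \<comment> \<open>Multiplying g by \<theta> x <= 1 preserves the weighted bound and changes g(0)
    so that x takes the place of m in the equation for the value at 0.\<close>
  define \<theta> where "\<theta> = (\<lambda>x. \<phi> x / \<phi> m)"
  have \<phi>m: "\<phi> m > 0" using m m2 by (simp add: \<phi>_def)
  have "((\<lambda>x. \<theta> x * l / x * (x - r) / (1 - x * r) powr (2 * b + 1)) \<longlongrightarrow>
     \<theta> m * l / m * (m - r) / (1 - m * r) powr (2 * b + 1)) (at_left m)"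
    unfolding \<theta>_def \<phi>_def using m m2 mr b by (intro tendsto_intros) auto
  moreover have "((\<lambda>x. \<theta> x * norm (g (of_real r))) \<longlongrightarrow> \<theta> m * norm (g (of_real r))) (at_left m)"
    unfolding \<theta>_def \<phi>_def using m m2 mr b by (intro tendsto_intros) auto
  moreover have "eventually (\<lambda>x. \<theta> x * l / x * (x - r) / (1 - x * r) powr (2 * b + 1) \<le> \<theta> x * norm (g (of_real r))) (at_left m)"
    unfolding eventually_at_left[OF rm]
  proof (intro exI[of _ r] conjI rm allI impI)
    fix x assume x: "r < x" "x < m"
    then have x0: "0 < x" using r by simp
    then have x2: "x\<^sup>2 < 1" using x m a by (simp add: power_less_one_iff)
    have \<theta>: "0 < \<theta> x" "\<theta> x \<le> 1" using mono[of x] x x0 \<phi>m x2 by (auto simp: \<theta>_def \<phi>_def)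
    have "\<theta> x * l / x * (x - r) / (1 - x * r) powr (2 * b + 1) \<le> norm (of_real (\<theta> x) * g (of_real r))"
    proof (rule weighted_growth_lower_bound_strict[where g = "\<lambda>z. of_real (\<theta> x) * g z"])
      show "(\<lambda>z. of_real (\<theta> x) * g z) holomorphic_on ball 0 1" by (intro holomorphic_intros hol)
      show "norm (of_real (\<theta> x) * g z) * (1 - (norm z)\<^sup>2) powr b \<le> 1" if "norm z < 1" for z
        using mult_mono[OF \<theta>(2) bd[OF that]] \<theta> by (simp add: norm_mult mult.assoc)
      show "\<theta> x * l * (a * (1 - a\<^sup>2) powr b) = x * (1 - x\<^sup>2) powr b"
      proof -
        have "\<theta> x * l * (a * (1 - a\<^sup>2) powr b) = \<theta> x * \<phi> m" by (simp only: mult.assoc l(2) \<phi>_def)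
        also have "\<dots> = \<phi> x" using \<phi>m by (simp add: \<theta>_def)
        finally show ?thesis by (simp only: \<phi>_def)
      qed
    qed (use a b m x x0 r l in auto)
    then show "\<theta> x * l / x * (x - r) / (1 - x * r) powr (2 * b + 1) \<le> \<theta> x * norm (g (of_real r))"
      using \<theta> by (simp add: norm_mult)
  qed
  ultimately have "\<theta> m * l / m * (m - r) / (1 - m * r) powr (2 * b + 1) \<le> \<theta> m * norm (g (of_real r))"
    by (intro tendsto_le[OF trivial_limit_at_left_real])
  then show ?thesis using \<phi>m by (simp add: \<theta>_def)
qed simp

section \<open>Derivatives of holomorphic maps of several variables\<close>

lemma continuous_on_vector_smult [continuous_intros]:
  fixes c :: "'a::topological_space \<Rightarrow> complex" and h :: "'a \<Rightarrow> complex^'n"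
  assumes "continuous_on S c" "continuous_on S h"
  shows "continuous_on S (\<lambda>x. c x *s h x)"
  unfolding vector_scalar_mult_def by (intro continuous_intros assms)

lemma bounded_linear_vector_smult: "bounded_linear (\<lambda>t. t *s h)" for h :: "complex^'n"
  by (intro linear_conv_bounded_linear[THEN iffD1] linearI)
    (simp_all add: vec_eq_iff algebra_simps)

lemma has_field_derivative_along_line:
  fixes f :: "complex^'n \<Rightarrow> complex^'m"
  assumes "(f has_derivative (\<lambda>h. A *v h)) (at (z + t *s h))"
  shows "((\<lambda>t. f (z + t *s h) $ i) has_field_derivative (A *v h) $ i) (at t)"
proof -
  have "((\<lambda>t. z + t *s h) has_derivative (\<lambda>t. t *s h)) (at t)"
    using has_derivative_add[OF has_derivative_const
        bounded_linear.has_derivative[OF bounded_linear_vector_smult has_derivative_ident]] by simp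
  from has_derivative_compose[OF this assms]
  have "((\<lambda>t. f (z + t *s h) $ i) has_derivative (\<lambda>t. (A *v (t *s h)) $ i)) (at t)"
    by (rule bounded_linear.has_derivative[OF bounded_linear_vec_nth])
  moreover have "(\<lambda>t. (A *v (t *s h)) $ i) = (*) ((A *v h) $ i)"
    by (simp add: fun_eq_iff vector_scalar_commute mult.commute)
  ultimately show ?thesis by (simp add: has_field_derivative_def)
qed

lemma matrix_vector_mult_axis: "(A *v axis j 1) $ i = A $ i $ j" for A :: "complex^'n^'m"
proof -
  have "A $ i $ k * axis j 1 $ k = (if k = j then A $ i $ k else 0)" for k
    by (simp add: axis_def)
  then show ?thesis by (simp add: matrix_vector_mult_def)
qed

lemma complex_jacobian_eq:
  fixes f :: "complex^'n \<Rightarrow> complex^'m"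
  assumes "(f has_derivative (\<lambda>h. A *v h)) (at z)"
  shows "complex_jacobian f z = A"
proof -
  have "deriv (\<lambda>w. f (\<chi> k. if k = j then w else z $ k) $ i) (z $ j) = A $ i $ j" for i j
  proof -
    define z' where "z' = (\<chi> k. if k = j then 0 else z $ k)"
    have e: "(\<chi> k. if k = j then w else z $ k) = z' + w *s axis j 1" for w
      by (simp add: vec_eq_iff z'_def axis_def)
    have "z = z' + z $ j *s axis j 1" by (simp add: vec_eq_iff z'_def axis_def)
    then have "(f has_derivative (\<lambda>h. A *v h)) (at (z' + z $ j *s axis j 1))" using assms by simp
    from has_field_derivative_along_line[OF this, of i]
    show ?thesis unfolding e
      by (simp add: DERIV_imp_deriv matrix_vector_mult_axis)
  qed
  then show ?thesis by (simp add: complex_jacobian_def vec_eq_iff)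
qed

lemma holomorphic_map_on_jacobian:
  fixes f :: "complex^'n \<Rightarrow> complex^'m"
  assumes "holomorphic_map_on f U" "z \<in> U"
  shows "(f has_derivative (\<lambda>h. complex_jacobian f z *v h)) (at z)"
  using assms complex_jacobian_eq[of f _ z] unfolding holomorphic_map_on_def by metis

lemma holomorphic_map_on_imp_continuous_on:
  assumes "holomorphic_map_on f U"
  shows "continuous_on U f"
  using assms has_derivative_continuous continuous_at_imp_continuous_on
  unfolding holomorphic_map_on_def by metis

lemma holomorphic_map_on_line:
  fixes f :: "complex^'n \<Rightarrow> complex^'m"
  assumes f: "holomorphic_map_on f U" and S: "\<And>t. t \<in> S \<Longrightarrow> z + t *s h \<in> U"
  shows "(\<lambda>t. f (z + t *s h) $ i) holomorphic_on S"
proof (rule holomorphic_onI)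
  fix t assume "t \<in> S"
  from has_field_derivative_along_line[OF holomorphic_map_on_jacobian[OF f S[OF this]]]
  show "(\<lambda>t. f (z + t *s h) $ i) field_differentiable at t within S"
    using field_differentiable_at_within field_differentiable_def by blast
qed

text \<open>Cauchy's formula for the derivative at 0 of t |-> f(z + t h). It expresses f' through
  values of f on a circle, so regularity of f passes to f'.\<close>

lemma directional_derivative_Cauchy:
  fixes f :: "complex^'n \<Rightarrow> complex^'m"
  assumes f: "holomorphic_map_on f U" and r: "r > 0"
    and U: "\<And>t. norm t \<le> r \<Longrightarrow> z + t *s h \<in> U"
  shows "(complex_jacobian f z *v h) $ i =
    integral {0..1} (\<lambda>x. f (z + circlepath 0 r x *s h) $ i / circlepath 0 r x)"
proof -
  define g where "g = (\<lambda>t. f (z + t *s h) $ i)"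
  define \<gamma> where "\<gamma> = circlepath 0 r"
  have hol: "g holomorphic_on cball 0 r" unfolding g_def
    by (rule holomorphic_map_on_line[OF f]) (use U in simp)
  have "z \<in> U" using U[of 0] r by simp
  then have "(g has_field_derivative (complex_jacobian f z *v h) $ i) (at 0)" unfolding g_def
    using has_field_derivative_along_line[of f "complex_jacobian f z" z 0 h i]
      holomorphic_map_on_jacobian[OF f] by simp
  then have "(complex_jacobian f z *v h) $ i = deriv g 0" by (simp add: DERIV_imp_deriv)
  also have "\<dots> = contour_integral \<gamma> (\<lambda>u. g u / u\<^sup>2) / (2 * pi * \<i>)" unfolding \<gamma>_def
    using Cauchy_contour_integral_circlepath_2[of 0 r g 0] r hol
      holomorphic_on_imp_continuous_on holomorphic_on_subset[OF hol ball_subset_cball] by auto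
  \<comment> \<open>The velocity 2 \<pi> i \<gamma> of the circle cancels one power of the squared
    denominator, and its constant the Cauchy factor.\<close>
  also have "contour_integral \<gamma> (\<lambda>u. g u / u\<^sup>2) = integral {0..1} (\<lambda>x. 2 * pi * \<i> * (g (\<gamma> x) / \<gamma> x))"
    unfolding contour_integral_integral
  proof (rule integral_cong)
    fix x :: real
    have "vector_derivative \<gamma> (at x) = 2 * pi * \<i> * \<gamma> x"
      by (simp add: \<gamma>_def vector_derivative_circlepath) (simp add: circlepath mult_ac)
    moreover have "\<gamma> x \<noteq> 0" using r by (simp add: \<gamma>_def circlepath)
    ultimately show "g (\<gamma> x) / (\<gamma> x)\<^sup>2 * vector_derivative \<gamma> (at x) = 2 * pi * \<i> * (g (\<gamma> x) / \<gamma> x)"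
      by (simp add: power2_eq_square)
  qed
  also have "\<dots> = 2 * pi * \<i> * integral {0..1} (\<lambda>x. g (\<gamma> x) / \<gamma> x)"
    by (rule integral_mult_right)
  finally show ?thesis by (simp add: g_def \<gamma>_def)
qed

text \<open>The radius is uniform in z near z0, so that one circle serves in Cauchy's formula while
  z varies.\<close>

lemma Cauchy_radius:
  fixes h z0 :: "complex^'n"
  assumes "open U" "z0 \<in> U"
  obtains e r where "e > 0" "r > 0" "\<And>z (t::complex). z \<in> ball z0 e \<Longrightarrow> norm t \<le> r \<Longrightarrow> z + t *s h \<in> U"
proof -
  obtain d where d: "d > 0" "ball z0 d \<subseteq> U" using assms open_contains_ball by metis
  have "continuous (at 0) (\<lambda>t. t *s h)"
    using bounded_linear_vector_smult by (intro linear_continuous_at)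
  then obtain s where s: "s > 0" "\<And>t::complex. norm t < s \<Longrightarrow> norm (t *s h) < d / 2"
    unfolding continuous_at_eps_delta using d(1) by (auto dest!: spec[of _ "d/2"])
  show ?thesis
  proof (rule that[of "d / 2" "s / 2"])
    fix z and t :: complex assume "z \<in> ball z0 (d / 2)" "norm t \<le> s / 2"
    then have "dist z0 z < d / 2" "norm (t *s h) < d / 2" using s by auto
    then have "dist z0 (z + t *s h) < d"
      using dist_triangle[of z0 "z + t *s h" z] by (simp add: dist_norm)
    then show "z + t *s h \<in> U" using d by auto
  qed (use d s in auto)
qed

text \<open>\<open>p\<close> is the moving centre: the identity for continuity of f', an affine line
  in the parameter for holomorphy.\<close>

lemma continuous_on_Cauchy_kernel:
  fixes F :: "complex^'n \<Rightarrow> complex"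
  assumes F: "continuous_on U F" and r: "r > 0"
    and p: "continuous_on E p" and U: "\<And>x t. x \<in> E \<Longrightarrow> norm t \<le> r \<Longrightarrow> p x + t *s h \<in> U"
  shows "continuous_on (E \<times> {0..1}) (\<lambda>(x, s). F (p x + circlepath 0 r s *s h) / circlepath 0 r s)"
proof -
  have n: "norm (circlepath 0 r s) = r" for s using r by (simp add: circlepath norm_mult)
  have nz: "circlepath 0 r s \<noteq> 0" for s using n[of s] r by auto
  have c: "continuous_on (E \<times> {0..1}) (\<lambda>y. circlepath 0 r (snd y))"
    unfolding circlepath by (intro continuous_intros)
  have px: "continuous_on (E \<times> {0..1::real}) (\<lambda>y. p (fst y))"
    by (rule continuous_on_compose2[OF p]) (auto intro: continuous_intros)
  have "continuous_on (E \<times> {0..1}) (\<lambda>y. F (p (fst y) + circlepath 0 r (snd y) *s h))"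
    by (rule continuous_on_compose2[OF F]) (use U n in \<open>auto intro!: continuous_intros c px\<close>)
  then show ?thesis unfolding split_beta
    using nz by (intro continuous_intros c) auto
qed

lemma continuous_on_directional_derivative:
  fixes f :: "complex^'n \<Rightarrow> complex^'m"
  assumes f: "holomorphic_map_on f U" and U: "open U"
  shows "continuous_on U (\<lambda>z. (complex_jacobian f z *v h) $ i)"
proof (rule continuous_at_imp_continuous_on, rule ballI)
  fix z0 assume "z0 \<in> U"
  then obtain e r where er: "e > 0" "r > 0" "\<And>z t. z \<in> ball z0 e \<Longrightarrow> norm t \<le> r \<Longrightarrow> z + t *s h \<in> U"
    using Cauchy_radius[OF U] by metis
  have "continuous_on (ball z0 e) (\<lambda>z. integral (cbox 0 1) (\<lambda>x. f (z + circlepath 0 r x *s h) $ i / circlepath 0 r x))"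
    using continuous_on_Cauchy_kernel[of U "\<lambda>z. f z $ i" r "ball z0 e" "\<lambda>z. z" h] er
      holomorphic_map_on_imp_continuous_on[OF f]
    by (intro integral_continuous_on_param) (auto intro: continuous_intros)
  moreover have "(complex_jacobian f z *v h) $ i =
      integral (cbox 0 1) (\<lambda>x. f (z + circlepath 0 r x *s h) $ i / circlepath 0 r x)" if "z \<in> ball z0 e" for z
    using directional_derivative_Cauchy[OF f er(2) er(3)[OF that]] by simp
  ultimately have "continuous_on (ball z0 e) (\<lambda>z. (complex_jacobian f z *v h) $ i)"
    by (rule continuous_on_eq[OF _ sym])
  then show "isCont (\<lambda>z. (complex_jacobian f z *v h) $ i) z0"
    using er(1) by (simp add: continuous_on_eq_continuous_at)
qed

lemma jacobian_entry: "complex_jacobian f z $ i $ j = (complex_jacobian f z *v axis j 1) $ i"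
  by (simp add: matrix_vector_mult_axis)

lemma continuous_on_jacobian:
  fixes f :: "complex^'n \<Rightarrow> complex^'m"
  assumes "holomorphic_map_on f U" and "open U"
  shows "continuous_on U (complex_jacobian f)"
proof -
  have "continuous_on U (\<lambda>z. \<chi> i j. complex_jacobian f z $ i $ j)"
    unfolding jacobian_entry by (intro continuous_on_vec_lambda continuous_on_directional_derivative[OF assms])
  then show ?thesis by simp
qed

text \<open>Differentiation under the integral sign in Cauchy's formula. The \<zeta>-derivative of
  the integrand is f' applied to u, already known to be continuous, so only first derivatives of f
  occur.\<close>

lemma directional_derivative_holomorphic_on_line:
  fixes f :: "complex^'n \<Rightarrow> complex^'m"
  assumes f: "holomorphic_map_on f U" and U: "open U" and S: "\<And>\<zeta>. \<zeta> \<in> S \<Longrightarrow> z + \<zeta> *s u \<in> U"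
  shows "(\<lambda>\<zeta>. (complex_jacobian f (z + \<zeta> *s u) *v h) $ i) holomorphic_on S"
proof (rule holomorphic_onI)
  fix \<zeta>0 assume "\<zeta>0 \<in> S"
  from S[OF this] obtain e r where er: "e > 0" "r > 0"
    "\<And>w t. w \<in> ball (z + \<zeta>0 *s u) e \<Longrightarrow> norm t \<le> r \<Longrightarrow> w + t *s h \<in> U"
    using Cauchy_radius[OF U] by metis
  have cl: "continuous_on A (\<lambda>\<zeta>. z + \<zeta> *s u)" for A by (intro continuous_intros)
  have "continuous (at \<zeta>0) (\<lambda>\<zeta>. z + \<zeta> *s u)"
    using cl[of UNIV] by (simp add: continuous_on_eq_continuous_at)
  then obtain d where d: "d > 0" "\<And>\<zeta>. dist \<zeta> \<zeta>0 < d \<Longrightarrow> dist (z + \<zeta> *s u) (z + \<zeta>0 *s u) < e"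
    unfolding continuous_at_eps_delta using er(1) by (auto simp: dist_norm)
  have fi: "continuous_on U (\<lambda>z. f z $ i)"
    by (intro continuous_intros holomorphic_map_on_imp_continuous_on[OF f])
  have inU: "z + \<zeta> *s u + t *s h \<in> U" if "\<zeta> \<in> ball \<zeta>0 d" "norm t \<le> r" for \<zeta> t
    using d(2)[of \<zeta>] er(3)[of _ t] that by (simp add: dist_commute)
  have "(\<lambda>\<zeta>. integral (cbox 0 1) (\<lambda>x. f (z + \<zeta> *s u + circlepath 0 r x *s h) $ i / circlepath 0 r x))
      holomorphic_on ball \<zeta>0 d"
  proof (rule leibniz_rule_holomorphic)
    fix \<zeta> x assume "\<zeta> \<in> ball \<zeta>0 d" "x \<in> cbox 0 (1::real)"
    have n: "norm (circlepath 0 r x) = r" using er by (simp add: circlepath norm_mult)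
    have "z + circlepath 0 r x *s h + \<zeta> *s u \<in> U"
      using inU[OF \<open>\<zeta> \<in> ball \<zeta>0 d\<close>, of "circlepath 0 r x"] n by (simp add: add_ac)
    from has_field_derivative_along_line[OF holomorphic_map_on_jacobian[OF f this]]
    have "((\<lambda>\<zeta>. f (z + \<zeta> *s u + circlepath 0 r x *s h) $ i) has_field_derivative
        (complex_jacobian f (z + \<zeta> *s u + circlepath 0 r x *s h) *v u) $ i) (at \<zeta> within ball \<zeta>0 d)"
      by (simp add: add_ac has_field_derivative_at_within)
    then show "((\<lambda>\<zeta>. f (z + \<zeta> *s u + circlepath 0 r x *s h) $ i / circlepath 0 r x) has_field_derivative
        (complex_jacobian f (z + \<zeta> *s u + circlepath 0 r x *s h) *v u) $ i / circlepath 0 r x) (at \<zeta> within ball \<zeta>0 d)"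
      by (rule DERIV_cdivide)
  next
    fix \<zeta> assume "\<zeta> \<in> ball \<zeta>0 d"
    have "continuous_on ({\<zeta>} \<times> {0..1}) (\<lambda>(\<zeta>, s). f (z + \<zeta> *s u + circlepath 0 r s *s h) $ i / circlepath 0 r s)"
      by (rule continuous_on_Cauchy_kernel[of U "\<lambda>z. f z $ i" r])
        (use er(2) inU \<open>\<zeta> \<in> ball \<zeta>0 d\<close> cl fi in auto)
    then have "continuous_on {0..1} (\<lambda>s. case (\<zeta>, s) of (\<zeta>, s) \<Rightarrow>
        f (z + \<zeta> *s u + circlepath 0 r s *s h) $ i / circlepath 0 r s)"
      by (rule continuous_on_compose2) (auto intro: continuous_intros)
    then show "(\<lambda>x. f (z + \<zeta> *s u + circlepath 0 r x *s h) $ i / circlepath 0 r x) integrable_on cbox 0 1"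
      by (simp add: integrable_continuous_real)
  next
    show "continuous_on (ball \<zeta>0 d \<times> cbox 0 1)
        (\<lambda>(\<zeta>, x). (complex_jacobian f (z + \<zeta> *s u + circlepath 0 r x *s h) *v u) $ i / circlepath 0 r x)"
      using continuous_on_Cauchy_kernel[OF continuous_on_directional_derivative[OF f U, of u i] er(2), of "ball \<zeta>0 d" "\<lambda>\<zeta>. z + \<zeta> *s u" h]
        inU cl by auto
  qed simp
  moreover have "(complex_jacobian f (z + \<zeta> *s u) *v h) $ i =
      integral (cbox 0 1) (\<lambda>x. f (z + \<zeta> *s u + circlepath 0 r x *s h) $ i / circlepath 0 r x)"
    if "\<zeta> \<in> ball \<zeta>0 d" for \<zeta>
    using directional_derivative_Cauchy[OF f er(2) inU[OF that]] by simp
  ultimately have "(\<lambda>\<zeta>. (complex_jacobian f (z + \<zeta> *s u) *v h) $ i) holomorphic_on ball \<zeta>0 d"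
    by (rule holomorphic_transform[OF _ sym])
  then show "(\<lambda>\<zeta>. (complex_jacobian f (z + \<zeta> *s u) *v h) $ i) field_differentiable at \<zeta>0 within S"
    using d(1) by (meson centre_in_ball field_differentiable_at_within holomorphic_on_imp_differentiable_at open_ball)
qed

lemma det_jacobian_holomorphic_on_line:
  fixes f :: "complex^'n \<Rightarrow> complex^'n"
  assumes "holomorphic_map_on f U" "open U" "\<And>\<zeta>. \<zeta> \<in> S \<Longrightarrow> z + \<zeta> *s u \<in> U"
  shows "(\<lambda>\<zeta>. det (complex_jacobian f (z + \<zeta> *s u))) holomorphic_on S"
proof -
  have "(\<lambda>\<zeta>. complex_jacobian f (z + \<zeta> *s u) $ i $ j) holomorphic_on S" for i j
    unfolding jacobian_entry by (rule directional_derivative_holomorphic_on_line[OF assms])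
  then show ?thesis unfolding det_def
    by (intro holomorphic_on_sum holomorphic_on_mult holomorphic_on_const holomorphic_on_prod)
qed

section \<open>Schlicht balls\<close>

text \<open>On the connected smaller ball the set of agreement is closed by continuity. It is open
  as the preimage of \<open>U1\<close> under the second branch: a point of \<open>U1\<close> over y
  must be the value of the first branch, f being injective there.\<close>

lemma inverse_branches_agree:
  fixes f :: "complex^'n \<Rightarrow> complex^'n"
  assumes 1: "open U1" "bij_betw f U1 (ball c r1)" "continuous_on (ball c r1) (inv_into U1 f)"
    and 2: "bij_betw f U2 (ball c r2)" "continuous_on (ball c r2) (inv_into U2 f)"
    and w: "w \<in> U1" "w \<in> U2" "f w = c" and r: "0 < r1" "r1 \<le> r2" and y: "y \<in> ball c r1"
  shows "inv_into U1 f y = inv_into U2 f y"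
proof -
  let ?g1 = "inv_into U1 f" and ?g2 = "inv_into U2 f"
  have sub: "ball c r1 \<subseteq> ball c r2" using r by auto
  have c2: "continuous_on (ball c r1) ?g2" using 2(2) sub continuous_on_subset by blast
  define S where "S = {y \<in> ball c r1. ?g1 y - ?g2 y = 0}"
  have in1: "?g1 y \<in> U1" if "y \<in> ball c r1" for y
    using that 1(2) by (metis bij_betw_imp_surj_on inv_into_into)
  have f2: "f (?g2 y) = y" if "y \<in> ball c r1" for y
    using that 2(1) sub by (metis bij_betw_inv_into_right subsetD)
  have inj1: "inj_on f U1" and inj2: "inj_on f U2" using 1(2) 2(1) by (auto simp: bij_betw_def)
  have "S = ball c r1 \<inter> ?g2 -` U1"
  proof (intro equalityI subsetI)
    fix y assume "y \<in> ball c r1 \<inter> ?g2 -` U1"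
    then have y: "y \<in> ball c r1" "?g2 y \<in> U1" by auto
    have "?g1 (f (?g2 y)) = ?g2 y" by (rule inv_into_f_f[OF inj1 y(2)])
    then show "y \<in> S" using f2 y by (simp add: S_def)
  next
    fix y assume "y \<in> S"
    then show "y \<in> ball c r1 \<inter> ?g2 -` U1" using in1[of y] by (auto simp: S_def)
  qed
  moreover have "open (ball c r1 \<inter> ?g2 -` U1)"
    by (intro continuous_open_preimage c2 1 open_ball)
  ultimately have "openin (top_of_set (ball c r1)) S" by (auto intro: open_subset)
  moreover have "closedin (top_of_set (ball c r1)) S" unfolding S_def
    by (intro continuous_closedin_preimage_constant continuous_intros 1 c2)
  moreover have "c \<in> S"
    using inv_into_f_f[OF inj1 w(1)] inv_into_f_f[OF inj2 w(2)] w r by (simp add: S_def)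
  ultimately have "S = ball c r1" using connected_clopen[of "ball c r1"] by auto
  then have "y \<in> S" using y by (simp only:)
  then show ?thesis by (simp add: S_def)
qed

text \<open>The branches over all admissible balls agree on overlaps and glue to one branch with
  values in the union of their domains \<open>U r\<close>.\<close>

lemma schlicht_ball_Sup:
  fixes f :: "complex^'n \<Rightarrow> complex^'n"
  assumes f: "holomorphic_map_on f (ball 0 1)" and ne: "{r. schlicht_ball f w r} \<noteq> {}"
    and bdd: "bdd_above {r. schlicht_ball f w r}"
  shows "schlicht_ball f w (Sup {r. schlicht_ball f w r})"
proof -
  define A where "A = {r. schlicht_ball f w r}"
  define \<rho> where "\<rho> = Sup A"
  have "\<forall>r\<in>A. \<exists>U. open U \<and> w \<in> U \<and> U \<subseteq> ball 0 1 \<and> biholomorphic_onto f U (ball (f w) r)"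
    by (auto simp: A_def schlicht_ball_def)
  from bchoice[OF this] obtain U where
    "\<forall>r\<in>A. open (U r) \<and> w \<in> U r \<and> U r \<subseteq> ball 0 1 \<and> biholomorphic_onto f (U r) (ball (f w) r)"
    by blast
  then have U: "open (U r)" "w \<in> U r" "U r \<subseteq> ball 0 1" "biholomorphic_onto f (U r) (ball (f w) r)"
    if "r \<in> A" for r using that by simp_all
  have pos: "r > 0" if "r \<in> A" for r using that by (simp add: A_def schlicht_ball_def)
  have bij: "bij_betw f (U r) (ball (f w) r)" and hol: "holomorphic_map_on (inv_into (U r) f) (ball (f w) r)"
    if "r \<in> A" for r using U(4)[OF that] by (auto simp: biholomorphic_onto_def)
  have le: "r \<le> \<rho>" if "r \<in> A" for r unfolding \<rho>_def by (rule cSup_upper[OF that]) (use bdd in \<open>simp add: A_def\<close>)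
  have ex: "\<exists>r\<in>A. y \<in> ball (f w) r" if "y \<in> ball (f w) \<rho>" for y
    using that less_cSup_iff[of A "dist (f w) y"] ne bdd by (auto simp: A_def \<rho>_def)
  define V where "V = (\<Union>r\<in>A. U r)"
  have agree: "z1 = z2" if "r \<in> A" "s \<in> A" "r \<le> s" "z1 \<in> U r" "z2 \<in> U s" "f z1 = f z2" for r s z1 z2
  proof -
    have i: "inj_on f (U r)" "inj_on f (U s)" using bij that by (auto simp: bij_betw_def)
    have y: "f z1 \<in> ball (f w) r" using bij[OF \<open>r \<in> A\<close>] \<open>z1 \<in> U r\<close> bij_betwE by blast
    have "inv_into (U r) f (f z1) = inv_into (U s) f (f z1)"
      using inverse_branches_agree[OF U(1) bij _ bij, of r s w] hol U(2) that y pos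
      by (simp add: holomorphic_map_on_imp_continuous_on)
    moreover have "inv_into (U r) f (f z1) = z1" using i(1) that(4) by (rule inv_into_f_f)
    moreover have "inv_into (U s) f (f z1) = z2" unfolding that(6) using i(2) that(5) by (rule inv_into_f_f)
    ultimately show ?thesis by simp
  qed
  have inj: "inj_on f V"
  proof (rule inj_onI)
    fix z1 z2 assume "z1 \<in> V" "z2 \<in> V" "f z1 = f z2"
    then obtain r s where "r \<in> A" "s \<in> A" "z1 \<in> U r" "z2 \<in> U s" by (auto simp: V_def)
    then show "z1 = z2" using agree[of r s z1 z2] agree[of s r z2 z1] \<open>f z1 = f z2\<close>
      by (cases "r \<le> s") auto
  qed
  have "f ` V = ball (f w) \<rho>"
  proof (intro equalityI subsetI)
    fix y assume "y \<in> f ` V"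
    then obtain r z where "r \<in> A" "z \<in> U r" "y = f z" by (auto simp: V_def)
    then have "y \<in> ball (f w) r" using bij bij_betwE by blast
    then show "y \<in> ball (f w) \<rho>" using le[OF \<open>r \<in> A\<close>] by auto
  next
    fix y assume "y \<in> ball (f w) \<rho>"
    from ex[OF this] obtain r where "r \<in> A" "y \<in> ball (f w) r" by auto
    then have "y \<in> f ` U r" using bij[of r] by (simp add: bij_betw_def)
    then show "y \<in> f ` V" using \<open>r \<in> A\<close> by (auto simp: V_def)
  qed
  then have bV: "bij_betw f V (ball (f w) \<rho>)" using inj by (simp add: bij_betw_def)
  have inv: "inv_into (U r) f y = inv_into V f y" if "r \<in> A" "y \<in> ball (f w) r" for r y
  proof -
    have "y \<in> f ` U r" using bij[of r] that by (simp add: bij_betw_def)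
    then have 1: "f (inv_into (U r) f y) = y" and "inv_into (U r) f y \<in> U r"
      by (rule f_inv_into_f, rule inv_into_into)
    then have "inv_into (U r) f y \<in> V" using that(1) by (auto simp: V_def)
    from inv_into_f_f[OF inj this] show ?thesis by (simp add: 1)
  qed
  have "holomorphic_map_on (inv_into V f) (ball (f w) \<rho>)"
    unfolding holomorphic_map_on_def
  proof
    fix y assume "y \<in> ball (f w) \<rho>"
    from ex[OF this] obtain r where r: "r \<in> A" "y \<in> ball (f w) r" by auto
    then obtain B where "(inv_into (U r) f has_derivative (\<lambda>h. B *v h)) (at y)"
      using hol[OF r(1)] unfolding holomorphic_map_on_def by blast
    then have "(inv_into V f has_derivative (\<lambda>h. B *v h)) (at y)"
      by (rule has_derivative_transform_within_open[OF _ open_ball r(2) inv[OF r(1)]])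
    then show "\<exists>B. (inv_into V f has_derivative (\<lambda>h. B *v h)) (at y)" by blast
  qed
  moreover have V: "open V" "V \<subseteq> ball 0 1" using U by (auto simp: V_def)
  moreover have "holomorphic_map_on f V" using f V(2) unfolding holomorphic_map_on_def by blast
  moreover have "w \<in> V \<and> \<rho> > 0"
  proof -
    obtain r where r: "r \<in> A" using ne by (auto simp: A_def)
    then have "w \<in> V" using U(2) by (auto simp: V_def)
    then show ?thesis using pos[OF r] le[OF r] by simp
  qed
  ultimately have "biholomorphic_onto f V (ball (f w) \<rho>)" "open V" "V \<subseteq> ball 0 1" "w \<in> V" "\<rho> > 0"
    using bV by (auto simp: biholomorphic_onto_def)
  then have "schlicht_ball f w \<rho>" unfolding schlicht_ball_def by blast
  then show ?thesis by (simp add: \<rho>_def A_def)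
qed

lemma biholomorphic_inverse_derivative:
  fixes f :: "complex^'n \<Rightarrow> complex^'n"
  assumes b: "biholomorphic_onto f U V" and o: "open U" "open V" and y: "y \<in> V"
  obtains B where "(inv_into U f has_derivative (\<lambda>h. B *v h)) (at y)"
    "\<And>h. complex_jacobian f (inv_into U f y) *v (B *v h) = h"
    "\<And>h. B *v (complex_jacobian f (inv_into U f y) *v h) = h"
proof -
  let ?g = "inv_into U f"
  have bij: "bij_betw f U V" and f: "holomorphic_map_on f U" and g: "holomorphic_map_on ?g V"
    using b by (auto simp: biholomorphic_onto_def)
  obtain B where B: "(?g has_derivative (\<lambda>h. B *v h)) (at y)"
    using g y unfolding holomorphic_map_on_def by blast
  have gy: "?g y \<in> U" and fg: "f (?g y) = y" using bij y
    by (auto simp: bij_betw_inv_into_right bij_betw_def inv_into_into)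
  note J = holomorphic_map_on_jacobian[OF f gy]
  have "((\<lambda>x. f (?g x)) has_derivative (\<lambda>h. complex_jacobian f (?g y) *v (B *v h))) (at y)"
    by (rule has_derivative_compose[OF B J])
  then have "((\<lambda>x. x) has_derivative (\<lambda>h. complex_jacobian f (?g y) *v (B *v h))) (at y)"
    by (rule has_derivative_transform_within_open[OF _ o(2) y]) (simp add: bij_betw_inv_into_right[OF bij])
  then have 1: "(\<lambda>h. complex_jacobian f (?g y) *v (B *v h)) = (\<lambda>h. h)"
    using has_derivative_unique has_derivative_ident by blast
  have "((\<lambda>x. ?g (f x)) has_derivative (\<lambda>h. B *v (complex_jacobian f (?g y) *v h))) (at (?g y))"
    by (rule has_derivative_compose[OF J]) (simp add: B fg)
  then have "((\<lambda>x. x) has_derivative (\<lambda>h. B *v (complex_jacobian f (?g y) *v h))) (at (?g y))"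
    by (rule has_derivative_transform_within_open[OF _ o(1) gy]) (simp add: bij_betw_inv_into_left[OF bij])
  then have 2: "(\<lambda>h. B *v (complex_jacobian f (?g y) *v h)) = (\<lambda>h. h)"
    using has_derivative_unique has_derivative_ident by blast
  show ?thesis using that B fun_cong[OF 1] fun_cong[OF 2] by blast
qed

text \<open>Liouville made quantitative. Along h = f'(w) e_i the i-th coordinate of the inverse
  branch is a function of one variable, bounded by 1, with derivative 1 at 0; if |h| < r it is
  holomorphic on a disc of radius above 1, against Cauchy's inequality.\<close>

lemma schlicht_ball_bound:
  fixes f :: "complex^'n \<Rightarrow> complex^'n"
  assumes "schlicht_ball f w r"
  shows "r \<le> norm (complex_jacobian f w *v axis i 1)"
proof -
  obtain U where U: "open U" "w \<in> U" "U \<subseteq> ball 0 1" "biholomorphic_onto f U (ball (f w) r)" and r: "r > 0"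
    using assms by (auto simp: schlicht_ball_def)
  let ?g = "inv_into U f"
  have bij: "bij_betw f U (ball (f w) r)" and g: "holomorphic_map_on ?g (ball (f w) r)"
    using U(4) by (auto simp: biholomorphic_onto_def)
  have gw: "?g (f w) = w" using bij U(2) by (simp add: bij_betw_inv_into_left)
  obtain B where B: "(?g has_derivative (\<lambda>h. B *v h)) (at (f w))" "\<And>h. B *v (complex_jacobian f w *v h) = h"
    using biholomorphic_inverse_derivative[OF U(4) U(1) open_ball, of "f w"] r gw by (metis centre_in_ball)
  define h where "h = complex_jacobian f w *v axis i 1"
  have Bh: "B *v h = axis i 1" by (simp add: h_def B)
  show ?thesis
  proof (rule ccontr)
    assume "\<not> ?thesis"
    then have hr: "norm h < r" by (simp add: h_def)
    have "h \<noteq> 0"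
    proof
      assume "h = 0"
      then show False using Bh by (simp add: axis_eq_0_iff)
    qed
    then have h0: "norm h > 0" by simp
    \<comment> \<open>The midpoint of 1 and r / |h|.\<close>
    define R where "R = (1 + r / norm h) / 2"
    have R: "R > 1" "R * norm h < r" using hr h0 by (auto simp: R_def field_simps)
    define p where "p = (\<lambda>t. ?g (f w + t *s h) $ i)"
    have inb: "f w + t *s h \<in> ball (f w) r" if "norm t \<le> R" for t :: complex
    proof -
      have "norm t * norm h \<le> R * norm h" using that by (intro mult_right_mono) auto
      then show ?thesis using R(2) by (simp add: dist_norm norm_vector_smult_complex)
    qed
    have hol: "p holomorphic_on cball 0 R" unfolding p_def
      by (rule holomorphic_map_on_line[OF g]) (use inb in simp)
    have "norm ((deriv ^^ 1) p 0) \<le> fact 1 * 1 / R ^ 1"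
    proof (rule Cauchy_inequality)
      show "p holomorphic_on ball 0 R" using hol ball_subset_cball holomorphic_on_subset by blast
      show "continuous_on (cball 0 R) p" using hol by (rule holomorphic_on_imp_continuous_on)
      show "R > 0" using R by simp
      fix t :: complex assume "norm (0 - t) = R"
      then have "?g (f w + t *s h) \<in> U"
        using inb[of t] bij by (simp add: bij_betw_def inv_into_into)
      then have "norm (?g (f w + t *s h)) \<le> 1" using U(3) by fastforce
      then show "norm (p t) \<le> 1" unfolding p_def
        by (rule order_trans[OF Finite_Cartesian_Product.norm_nth_le])
    qed
    moreover have "(p has_field_derivative (B *v h) $ i) (at 0)" unfolding p_def
      by (rule has_field_derivative_along_line) (use B in simp)
    then have "deriv p 0 = 1" unfolding Bh by (simp add: DERIV_imp_deriv)
    ultimately have "1 \<le> 1 / R" by simp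
    then show False using R by (simp add: field_simps)
  qed
qed

lemma schlicht_radius_attained:
  fixes f :: "complex^'n \<Rightarrow> complex^'n"
  assumes f: "holomorphic_map_on f (ball 0 1)" and "schlicht_ball f w r0"
  shows "schlicht_ball f w (schlicht_radius w f)"
    and "schlicht_ball f w r \<Longrightarrow> r \<le> schlicht_radius w f"
proof -
  let ?A = "{r. schlicht_ball f w r}"
  \<comment> \<open>\<open>undefined\<close> is an arbitrary coordinate; the bound from any one of
    them suffices.\<close>
  have bdd: "bdd_above ?A" using schlicht_ball_bound[of f w _ undefined] by (auto simp: bdd_above_def)
  have S: "schlicht_ball f w (Sup ?A)" by (rule schlicht_ball_Sup) (use assms bdd in auto)
  have up: "r \<le> Sup ?A" if "schlicht_ball f w r" for r using that bdd by (intro cSup_upper) auto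
  have eq: "schlicht_radius w f = Sup ?A" unfolding schlicht_radius_def
    by (rule Greatest_equality) (use S up in auto)
  show "schlicht_ball f w (schlicht_radius w f)" unfolding eq by (rule S)
  show "schlicht_ball f w r \<Longrightarrow> r \<le> schlicht_radius w f" unfolding eq by (rule up)
qed

section \<open>Extension of an inverse branch past a closed ball\<close>

text \<open>Otherwise there are pairs of distinct points with equal images whose distance to K tends
  to 0. Limits along a common subsequence have equal images, so they coincide in K, and injectivity
  near that limit is violated.\<close>

lemma inj_on_neighbourhood_of_compact:
  fixes f :: "'a::metric_space \<Rightarrow> 'b::t2_space"
  assumes K: "compact K" "K \<subseteq> U" "inj_on f K" and U: "open U" "continuous_on U f"
    and loc: "\<And>z. z \<in> K \<Longrightarrow> \<exists>e>0. inj_on f (ball z e)"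
  obtains N where "open N" "K \<subseteq> N" "N \<subseteq> U" "inj_on f N"
proof -
  define N where "N = (\<lambda>k::nat. U \<inter> (\<Union>z\<in>K. ball z (inverse (Suc k))))"
  have "\<exists>k. inj_on f (N k)"
  proof (rule ccontr)
    assume "\<not> ?thesis"
    then have "\<forall>k. \<exists>x y. x \<in> N k \<and> y \<in> N k \<and> f x = f y \<and> x \<noteq> y" unfolding inj_on_def by blast
    then obtain x y where xy: "\<And>k. x k \<in> N k" "\<And>k. y k \<in> N k" "\<And>k. f (x k) = f (y k)" "\<And>k. x k \<noteq> y k"
      by metis
    have "\<forall>k. \<exists>a b. a \<in> K \<and> b \<in> K \<and> dist a (x k) < inverse (Suc k) \<and> dist b (y k) < inverse (Suc k)"
      using xy(1,2) unfolding N_def by (auto; blast)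
    then obtain a b where ab: "\<And>k. a k \<in> K" "\<And>k. b k \<in> K" "\<And>k. dist (a k) (x k) < inverse (Suc k)"
      "\<And>k. dist (b k) (y k) < inverse (Suc k)" by metis
    have "seq_compact (K \<times> K)" using K(1) compact_Times compact_imp_seq_compact by blast
    moreover have "\<forall>k. (a k, b k) \<in> K \<times> K" using ab(1,2) by simp
    ultimately obtain p \<sigma> where p: "p \<in> K \<times> K" and \<sigma>: "strict_mono \<sigma>"
      and lim: "((\<lambda>k. (a k, b k)) \<circ> \<sigma>) \<longlonglongrightarrow> p"
      by (rule seq_compactE)
    obtain a0 b0 where p0: "p = (a0, b0)" by (cases p)
    have la: "(\<lambda>k. a (\<sigma> k)) \<longlonglongrightarrow> a0" and lb: "(\<lambda>k. b (\<sigma> k)) \<longlonglongrightarrow> b0"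
      using tendsto_fst[OF lim] tendsto_snd[OF lim] by (simp_all add: o_def p0)
    have z: "(\<lambda>k. inverse (real (Suc (\<sigma> k)))) \<longlonglongrightarrow> 0"
      using LIMSEQ_subseq_LIMSEQ[OF LIMSEQ_inverse_real_of_nat \<sigma>] by (simp add: o_def)
    have close: "(\<lambda>k. u (\<sigma> k)) \<longlonglongrightarrow> l"
      if "(\<lambda>k. v (\<sigma> k)) \<longlonglongrightarrow> l" and d: "\<And>k. dist (v k) (u k) < inverse (Suc k)" for u v :: "nat \<Rightarrow> 'a" and l
    proof -
      have lim: "(\<lambda>k. inverse (real (Suc (\<sigma> k))) + dist (v (\<sigma> k)) l) \<longlonglongrightarrow> 0"
        using tendsto_add[OF z tendsto_dist[OF that(1) tendsto_const[of l]]] by simp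
      have le: "dist (u (\<sigma> k)) l \<le> inverse (real (Suc (\<sigma> k))) + dist (v (\<sigma> k)) l" for k
        using dist_triangle[of "u (\<sigma> k)" l "v (\<sigma> k)"] d[of "\<sigma> k"] by (simp add: dist_commute)
      have "(\<lambda>k. dist (u (\<sigma> k)) l) \<longlonglongrightarrow> 0"
        by (rule tendsto_sandwich[OF _ _ tendsto_const lim]) (intro always_eventually allI le zero_le_dist)+
      then show ?thesis by (rule tendsto_dist_iff[THEN iffD2])
    qed
    note lx = close[OF la ab(3)] and ly = close[OF lb ab(4)]
    have K0: "a0 \<in> K" "b0 \<in> K" using p p0 by auto
    have "isCont f a0" "isCont f b0" using U K0 K(2) by (auto simp: continuous_on_eq_continuous_at)
    from isCont_tendsto_compose[OF this(1) lx] isCont_tendsto_compose[OF this(2) ly]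
    have "f a0 = f b0" unfolding xy(3) by (rule LIMSEQ_unique)
    then have e0: "a0 = b0" using K(3) K0 by (auto dest: inj_onD)
    obtain e where e: "e > 0" "inj_on f (ball a0 e)" using loc K0 by blast
    have "\<forall>\<^sub>F k in sequentially. x (\<sigma> k) \<in> ball a0 e" "\<forall>\<^sub>F k in sequentially. y (\<sigma> k) \<in> ball a0 e"
      using topological_tendstoD[OF lx open_ball, of a0 e] topological_tendstoD[OF ly open_ball, of a0 e] e0 e(1)
      by simp_all
    then have "\<forall>\<^sub>F k in sequentially. False"
      by eventually_elim (use e(2) xy(3,4) in \<open>blast dest: inj_onD\<close>)
    then show False by simp
  qed
  then obtain k where "inj_on f (N k)" by blast
  moreover have "open (N k)" "N k \<subseteq> U" using U(1) by (auto simp: N_def)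
  moreover have "K \<subseteq> N k" using K(2) by (force simp: N_def)
  ultimately show ?thesis using that by blast
qed

lemma matrix_vector_mult_norm_le_sum:
  fixes A :: "complex^'n^'m"
  shows "norm (A *v x) \<le> (\<Sum>i\<in>UNIV. \<Sum>j\<in>UNIV. cmod (A $ i $ j)) * norm x"
proof -
  have "norm (A *v x) \<le> (\<Sum>i\<in>UNIV. cmod ((A *v x) $ i))"
    unfolding norm_vec_def by (rule L2_set_le_sum) simp
  also have "\<dots> \<le> (\<Sum>i\<in>UNIV. \<Sum>j\<in>UNIV. cmod (A $ i $ j) * norm x)"
  proof (rule sum_mono)
    fix i
    have "cmod ((A *v x) $ i) \<le> (\<Sum>j\<in>UNIV. cmod (A $ i $ j * x $ j))"
      by (simp add: matrix_vector_mult_def norm_sum)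
    also have "\<dots> \<le> (\<Sum>j\<in>UNIV. cmod (A $ i $ j) * norm x)"
      by (intro sum_mono) (simp add: norm_mult mult_left_mono Finite_Cartesian_Product.norm_nth_le)
    finally show "cmod ((A *v x) $ i) \<le> (\<Sum>j\<in>UNIV. cmod (A $ i $ j) * norm x)" .
  qed
  finally show ?thesis by (simp add: sum_distrib_right)
qed

lemma det_nonzero_inverse:
  fixes A :: "complex^'n^'n"
  assumes "det A \<noteq> 0"
  obtains B where "\<And>h. A *v (B *v h) = h" "\<And>h. B *v (A *v h) = h"
proof -
  obtain B where "A ** B = mat 1" "B ** A = mat 1"
    using assms invertible_det_nz[of A] unfolding invertible_def by blast
  then show ?thesis using that by (metis matrix_vector_mul_assoc matrix_vector_mul_lid)
qed

text \<open>The injectivity half of the inverse function theorem. Its smallness condition on f'(x) -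
  f'(z) follows from continuity of the entries, whose absolute sum dominates the operator
  norm.\<close>

lemma holomorphic_map_locally_injective:
  fixes f :: "complex^'n \<Rightarrow> complex^'n"
  assumes f: "holomorphic_map_on f U" and U: "open U" "z \<in> U" and nz: "det (complex_jacobian f z) \<noteq> 0"
  shows "\<exists>e>0. inj_on f (ball z e)"
proof -
  obtain B where B: "\<And>h. B *v (complex_jacobian f z *v h) = h"
    using det_nonzero_inverse[OF nz] by metis
  let ?s = "\<lambda>x. \<Sum>i\<in>UNIV. \<Sum>j\<in>UNIV. cmod ((complex_jacobian f x - complex_jacobian f z) $ i $ j)"
  have "continuous_on U ?s" by (intro continuous_intros continuous_on_jacobian[OF f U(1)])
  then have cont: "isCont ?s z" using U by (simp add: continuous_on_eq_continuous_at)
  have small: "\<exists>d>0. \<forall>x. dist z x < d \<longrightarrow>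
      onorm (\<lambda>v. complex_jacobian f x *v v - complex_jacobian f z *v v) < e" if e: "e > 0" for e
  proof -
    obtain d where d: "d > 0" "\<And>x. dist x z < d \<Longrightarrow> dist (?s x) (?s z) < e"
      using cont e unfolding continuous_at_eps_delta dist_norm by metis
    have "onorm (\<lambda>v. complex_jacobian f x *v v - complex_jacobian f z *v v) < e" if "dist z x < d" for x
    proof -
      have "onorm (\<lambda>v. complex_jacobian f x *v v - complex_jacobian f z *v v) \<le> ?s x"
        by (rule onorm_le) (metis matrix_vector_mult_norm_le_sum matrix_vector_mult_diff_rdistrib)
      also have "?s x < e" using d(2)[of x] that by (simp add: dist_commute)
      finally show ?thesis .
    qed
    then show ?thesis using d(1) by blast
  qed
  obtain r where "r > 0" "ball z r \<subseteq> U" "inj_on f (ball z r)"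
  proof (rule has_derivative_locally_injective[of z U "\<lambda>h. B *v h" "\<lambda>x h. complex_jacobian f x *v h" f])
    show "(\<lambda>h. B *v h) \<circ> (\<lambda>h. complex_jacobian f z *v h) = id" using B by auto
    show "bounded_linear (\<lambda>h. B *v h)" by (rule bounded_linear_matrix_vector_mult_complex)
  qed (use U holomorphic_map_on_jacobian[OF f] small in auto)
  then show ?thesis by blast
qed

lemma cball_subset_open_imp_bigger_ball:
  fixes c :: "'a::euclidean_space"
  assumes "cball c \<rho> \<subseteq> S" "open S" "\<rho> \<ge> 0"
  obtains r where "r > \<rho>" "ball c r \<subseteq> S"
proof -
  obtain e where e: "e > 0" "(\<Union>x\<in>cball c \<rho>. ball x e) \<subseteq> S"
    using compact_subset_open_imp_ball_epsilon_subset[OF compact_cball assms(2,1)] by metis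
  have "ball c (\<rho> + e) \<subseteq> S"
  proof
    fix y assume y: "y \<in> ball c (\<rho> + e)"
    \<comment> \<open>\<open>x\<close> is \<open>y\<close> pulled towards the centre just far enough
      to land in the closed ball.\<close>
    define x where "x = c + (\<rho> / (\<rho> + e)) *\<^sub>R (y - c)"
    have n: "norm (y - c) < \<rho> + e" using y by (simp add: dist_norm norm_minus_commute)
    have q: "0 < \<rho> + e" using e assms by simp
    have "x \<in> cball c \<rho>"
    proof -
      have "\<rho> / (\<rho> + e) * norm (y - c) \<le> \<rho> / (\<rho> + e) * (\<rho> + e)"
        using n q assms by (intro mult_left_mono) auto
      then show ?thesis using q assms by (simp add: x_def dist_norm)
    qed
    moreover have "y \<in> ball x e"
    proof -
      have "y - x = (e / (\<rho> + e)) *\<^sub>R (y - c)"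
      proof -
        have "e / (\<rho> + e) = 1 - \<rho> / (\<rho> + e)" using q by (simp add: field_simps)
        then show ?thesis by (simp only: x_def scaleR_diff_left) simp
      qed
      then have "norm (y - x) = e / (\<rho> + e) * norm (y - c)" using e q by simp
      also have "\<dots> < e / (\<rho> + e) * (\<rho> + e)" using n q e by (intro mult_strict_left_mono) auto
      finally show ?thesis using q by (simp add: dist_norm norm_minus_commute)
    qed
    ultimately show "y \<in> S" using e(2) by blast
  qed
  then show ?thesis using that[of "\<rho> + e"] e by simp
qed

text \<open>Injectivity spreads from K to an open set \<open>N\<close>, whose image is open by
  invariance of domain and so contains a ball larger than the given closed one. With K = {0} and
  \<rho> = 0 this yields a first schlicht ball; with K the closure of a branch domain it extends the
  branch.\<close>

lemma schlicht_ball_enlarge: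
  fixes f :: "complex^'n \<Rightarrow> complex^'n"
  assumes f: "holomorphic_map_on f (ball 0 1)"
    and K: "compact K" "K \<subseteq> ball 0 1" "inj_on f K" "\<And>z. z \<in> K \<Longrightarrow> det (complex_jacobian f z) \<noteq> 0"
    and w: "w \<in> K" and \<rho>: "\<rho> \<ge> 0" "cball (f w) \<rho> \<subseteq> f ` K"
  shows "\<exists>r>\<rho>. schlicht_ball f w r"
proof -
  define G where "G = ball 0 1 \<inter> (\<lambda>z. det (complex_jacobian f z)) -` (- {0})"
  have "continuous_on (ball 0 1) (\<lambda>z. det (complex_jacobian f z))"
    using continuous_on_compose2[OF continuous_on_det continuous_on_jacobian[OF f open_ball]] by simp
  then have G: "open G" unfolding G_def by (intro continuous_open_preimage) auto
  have fG: "continuous_on G f"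
    using holomorphic_map_on_imp_continuous_on[OF f] continuous_on_subset unfolding G_def by blast
  obtain N where N: "open N" "K \<subseteq> N" "N \<subseteq> G" "inj_on f N"
  proof (rule inj_on_neighbourhood_of_compact[OF K(1) _ K(3) G fG])
    show "K \<subseteq> G" using K by (auto simp: G_def)
    show "\<exists>e>0. inj_on f (ball z e)" if "z \<in> K" for z
      using holomorphic_map_locally_injective[OF f open_ball] K that by blast
  qed
  have fN: "continuous_on N f" using fG N(3) continuous_on_subset by blast
  have "open (f ` N)" by (rule invariance_of_domain[OF fN N(1,4)])
  moreover have "cball (f w) \<rho> \<subseteq> f ` N" using \<rho>(2) image_mono[OF N(2), of f] by (rule order_trans)
  ultimately obtain r where r: "r > \<rho>" "ball (f w) r \<subseteq> f ` N"
    using cball_subset_open_imp_bigger_ball[of "f w" \<rho> "f ` N"] \<rho>(1) by blast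
  define V where "V = N \<inter> f -` ball (f w) r"
  have V: "open V" "V \<subseteq> G" "inj_on f V" "continuous_on V f"
    using N(3) inj_on_subset[OF N(4), of V] continuous_on_subset[OF fN, of V]
      continuous_open_preimage[OF fN N(1) open_ball] by (auto simp: V_def)
  have "f ` V = ball (f w) r" using r(2) by (auto simp: V_def)
  then have bij: "bij_betw f V (ball (f w) r)" using V(3) by (simp add: bij_betw_def)
  have "holomorphic_map_on (inv_into V f) (ball (f w) r)" unfolding holomorphic_map_on_def
  proof
    fix y assume y: "y \<in> ball (f w) r"
    let ?z = "inv_into V f y"
    have z: "?z \<in> V" "f ?z = y"
      using bij y by (auto simp: bij_betw_inv_into_right bij_betw_def inv_into_into)
    then have zG: "?z \<in> ball 0 1" "det (complex_jacobian f ?z) \<noteq> 0" using V(2) by (auto simp: G_def)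
    obtain B where B: "\<And>h. complex_jacobian f ?z *v (B *v h) = h" using det_nonzero_inverse[OF zG(2)] by metis
    have "(inv_into V f has_derivative (\<lambda>h. B *v h)) (at y)"
      by (rule has_derivative_inverse_strong_x[where S = V and f = f and f' = "\<lambda>h. complex_jacobian f ?z *v h"])
        (use V z B holomorphic_map_on_jacobian[OF f zG(1)] in \<open>auto simp: inv_into_f_f\<close>)
    then show "\<exists>B. (inv_into V f has_derivative (\<lambda>h. B *v h)) (at y)" by blast
  qed
  moreover have "holomorphic_map_on f V" "V \<subseteq> ball 0 1" "w \<in> V"
    using f V(2) r(1) \<rho>(1) w N(2) unfolding holomorphic_map_on_def G_def V_def by auto
  ultimately have "schlicht_ball f w r"
    unfolding schlicht_ball_def biholomorphic_onto_def using bij V(1) r(1) \<rho>(1) by auto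
  then show ?thesis using r(1) by blast
qed

text \<open>
  Along the inverse image \<open>\<gamma>\<close> of a segment of length \<open>d\<close> starting at \<open>f 0\<close>, the hypothesis says
  \<open>\<omega> \<bar>\<gamma>\<bar> \<bar>\<gamma>'\<bar> \<le> d\<close>, so that the primitive of \<open>\<omega>\<close> at \<open>\<bar>\<gamma>\<bar>\<close> grows at most by \<open>d\<close>.
\<close>

lemma integral_norm_inverse_branch_le:
  fixes f :: "complex^'n \<Rightarrow> complex^'n" and \<omega> :: "real \<Rightarrow> real"
  assumes b: "biholomorphic_onto f U (ball (f 0) \<rho>)" and U: "open U" "0 \<in> U" "U \<subseteq> ball 0 1"
    and \<omega>: "continuous_on UNIV \<omega>" "\<And>t. \<omega> t \<ge> 0"
    and lower: "\<And>z h. norm z < 1 \<Longrightarrow> \<omega> (norm z) * norm h \<le> norm (complex_jacobian f z *v h)"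
    and y: "y \<in> ball (f 0) \<rho>"
  shows "integral {0..norm (inv_into U f y)} \<omega> \<le> norm (y - f 0)"
proof -
  let ?g = "inv_into U f"
  have bij: "bij_betw f U (ball (f 0) \<rho>)" and g: "holomorphic_map_on ?g (ball (f 0) \<rho>)"
    using b by (auto simp: biholomorphic_onto_def)
  have g0: "?g (f 0) = 0" using bij U(2) by (simp add: bij_betw_inv_into_left)
  define v where "v = y - f 0"
  define \<gamma> where "\<gamma> = (\<lambda>s. ?g (f 0 + s *\<^sub>R v))"
  define \<Omega> where "\<Omega> = (\<lambda>t. integral {0..t} \<omega>)"
  have in_ball: "f 0 + s *\<^sub>R v \<in> ball (f 0) \<rho>" if "s \<in> {0..1}" for s
  proof -
    have "norm (s *\<^sub>R v) \<le> norm v" using that by (simp add: mult_left_le_one_le)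
    then show ?thesis using y by (simp add: dist_norm v_def norm_minus_commute)
  qed
  have \<gamma>U: "\<gamma> s \<in> U" "f (\<gamma> s) = f 0 + s *\<^sub>R v" if "s \<in> {0..1}" for s
    using in_ball[OF that] bij unfolding \<gamma>_def
    by (auto simp: bij_betw_inv_into_right bij_betw_def inv_into_into)
  have \<gamma>1: "norm (\<gamma> s) < 1" if "s \<in> {0..1}" for s using \<gamma>U(1)[OF that] U(3) by auto
  have \<Omega>: "(\<Omega> has_real_derivative \<omega> t) (at t)" if t: "0 < t" "t < 1" for t
  proof -
    have "(\<Omega> has_real_derivative \<omega> t) (at t within {0..1})" unfolding \<Omega>_def
      by (rule integral_has_real_derivative) (use t continuous_on_subset[OF \<omega>(1)] in auto)
    moreover have "at t within {0..1} = at t" using t by (intro at_within_interior) auto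
    ultimately show ?thesis by simp
  qed
  have \<Omega>c: "continuous_on {0..1} \<Omega>" unfolding \<Omega>_def
    by (intro indefinite_integral_continuous_1 integrable_continuous_real continuous_on_subset[OF \<omega>(1)]) auto
  have cont: "continuous_on {0..1} \<gamma>" unfolding \<gamma>_def
    by (rule continuous_on_compose2[OF holomorphic_map_on_imp_continuous_on[OF g]])
      (use in_ball in \<open>auto intro!: continuous_intros\<close>)
  show ?thesis
  proof (cases "v = 0")
    case True
    then have "y = f 0" by (simp add: v_def)
    then show ?thesis by (simp add: g0)
  next
    case False
    \<comment> \<open>The norm is not differentiable at 0. Since f(\<gamma> s) differs from f(0) for
      s > 0, the chain rule holds on the open interval, which is enough for the mean value
      theorem.\<close>
    have \<gamma>0: "\<gamma> s \<noteq> 0" if "0 < s" "s \<le> 1" for s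
      using \<gamma>U(2)[of s] that False by auto
    have "\<forall>s\<in>{0<..<1}. \<exists>D. ((\<lambda>s. \<Omega> (norm (\<gamma> s))) has_derivative (\<lambda>x. x * D)) (at s) \<and> D \<le> norm v"
    proof
      fix s :: real assume s: "s \<in> {0<..<1}"
      then have s': "s \<in> {0..1}" by auto
      obtain B where B: "(?g has_derivative (\<lambda>h. B *v h)) (at (f 0 + s *\<^sub>R v))"
        "\<And>h. complex_jacobian f (\<gamma> s) *v (B *v h) = h"
        using biholomorphic_inverse_derivative[OF b U(1) open_ball in_ball[OF s']] unfolding \<gamma>_def by metis
      have nz: "\<gamma> s \<noteq> 0" using \<gamma>0 s by auto
      have "((\<lambda>s. f 0 + s *\<^sub>R v) has_derivative (\<lambda>x. x *\<^sub>R v)) (at s)"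
        by (auto intro!: derivative_eq_intros)
      from has_derivative_compose[OF this B(1)]
      have d\<gamma>: "(\<gamma> has_derivative (\<lambda>x. B *v (x *\<^sub>R v))) (at s)" unfolding \<gamma>_def .
      have "((\<lambda>s. norm (\<gamma> s)) has_derivative (\<lambda>x. (B *v (x *\<^sub>R v)) \<bullet> sgn (\<gamma> s))) (at s)"
        by (rule has_derivative_compose[OF d\<gamma> has_derivative_norm[OF nz]])
      moreover have "(\<Omega> has_derivative (*) (\<omega> (norm (\<gamma> s)))) (at (norm (\<gamma> s)))"
        using \<Omega>[of "norm (\<gamma> s)"] nz \<gamma>1[OF s'] by (simp add: has_field_derivative_def)
      ultimately have "((\<lambda>s. \<Omega> (norm (\<gamma> s))) has_derivative
          (\<lambda>x. \<omega> (norm (\<gamma> s)) * ((B *v (x *\<^sub>R v)) \<bullet> sgn (\<gamma> s)))) (at s)"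
        by (rule has_derivative_compose)
      moreover have "B *v (x *\<^sub>R v) = x *\<^sub>R (B *v v)" for x
        by (rule linear_cmul) (rule bounded_linear.linear[OF bounded_linear_matrix_vector_mult_complex])
      ultimately have "((\<lambda>s. \<Omega> (norm (\<gamma> s))) has_derivative
          (\<lambda>x. x * (\<omega> (norm (\<gamma> s)) * ((B *v v) \<bullet> sgn (\<gamma> s))))) (at s)"
        by (simp add: mult_ac)
      moreover have "\<omega> (norm (\<gamma> s)) * ((B *v v) \<bullet> sgn (\<gamma> s)) \<le> norm v"
      proof -
        have "(B *v v) \<bullet> sgn (\<gamma> s) \<le> norm (B *v v)"
          using norm_cauchy_schwarz[of "B *v v" "sgn (\<gamma> s)"] nz by (simp add: norm_sgn)
        then have "\<omega> (norm (\<gamma> s)) * ((B *v v) \<bullet> sgn (\<gamma> s)) \<le> \<omega> (norm (\<gamma> s)) * norm (B *v v)"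
          by (intro mult_left_mono \<omega>(2))
        also have "\<dots> \<le> norm v" using lower[OF \<gamma>1[OF s'], of "B *v v"] by (simp add: B(2))
        finally show ?thesis .
      qed
      ultimately show "\<exists>D. ((\<lambda>s. \<Omega> (norm (\<gamma> s))) has_derivative (\<lambda>x. x * D)) (at s) \<and> D \<le> norm v"
        by blast
    qed
    then obtain D where D: "\<And>s. 0 < s \<Longrightarrow> s < 1 \<Longrightarrow>
        ((\<lambda>s. \<Omega> (norm (\<gamma> s))) has_derivative (\<lambda>x. x * D s)) (at s)"
      "\<And>s. 0 < s \<Longrightarrow> s < 1 \<Longrightarrow> D s \<le> norm v"
      by (metis greaterThanLessThan_iff)
    have "continuous_on {0..1} (\<lambda>s. \<Omega> (norm (\<gamma> s)))"
      by (rule continuous_on_compose2[OF \<Omega>c])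
        (auto intro!: continuous_on_norm cont simp: less_imp_le[OF \<gamma>1])
    then obtain \<xi> where "0 < \<xi>" "\<xi> < 1" "\<Omega> (norm (\<gamma> 1)) - \<Omega> (norm (\<gamma> 0)) = (1 - 0) * D \<xi>"
      using mvt[of 0 1 "\<lambda>s. \<Omega> (norm (\<gamma> s))" "\<lambda>s x. x * D s"] D(1) by (metis zero_less_one)
    moreover have "\<gamma> 0 = 0" "\<gamma> 1 = ?g y" by (simp_all add: \<gamma>_def g0 v_def)
    ultimately have "\<Omega> (norm (?g y)) \<le> norm v" using D(2)[of \<xi>] by (simp add: \<Omega>_def)
    then show ?thesis by (simp add: \<Omega>_def v_def)
  qed
qed

text \<open>
  If the largest radius were smaller than the integral, the inverse branch would stay in a compact
  subset of the ball and be Lipschitz there, so \<open>f\<close> would be injective on the closure of its image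
  and the branch could be extended to a larger ball.
\<close>

lemma schlicht_radius_ge_integral:
  fixes f :: "complex^'n \<Rightarrow> complex^'n" and \<omega> :: "real \<Rightarrow> real"
  assumes f: "holomorphic_map_on f (ball 0 1)" and m: "0 < m" "m \<le> 1"
    and \<omega>: "continuous_on UNIV \<omega>" "\<And>t. \<omega> t \<ge> 0" "\<And>t. 0 \<le> t \<Longrightarrow> t < m \<Longrightarrow> \<omega> t > 0"
    and lower: "\<And>z h. norm z < 1 \<Longrightarrow> \<omega> (norm z) * norm h \<le> norm (complex_jacobian f z *v h)"
    and det: "\<And>z. norm z < m \<Longrightarrow> det (complex_jacobian f z) \<noteq> 0"
  shows "schlicht_ball f 0 (schlicht_radius 0 f)" "integral {0..m} \<omega> \<le> schlicht_radius 0 f"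
proof -
  define \<rho> where "\<rho> = schlicht_radius 0 f"
  have "\<exists>r>0. schlicht_ball f 0 r"
    by (rule schlicht_ball_enlarge[OF f, of "{0}"]) (use det m in auto)
  then obtain r0 where "schlicht_ball f 0 r0" by blast
  note attained = schlicht_radius_attained[OF f this]
  show sb: "schlicht_ball f 0 (schlicht_radius 0 f)" by (rule attained)
  then obtain U where U: "open U" "0 \<in> U" "U \<subseteq> ball 0 1" "biholomorphic_onto f U (ball (f 0) \<rho>)" and \<rho>: "\<rho> > 0"
    by (auto simp: schlicht_ball_def \<rho>_def)
  let ?g = "inv_into U f"
  have bij: "bij_betw f U (ball (f 0) \<rho>)" and g: "holomorphic_map_on ?g (ball (f 0) \<rho>)"
    using U(4) by (auto simp: biholomorphic_onto_def)
  define \<Omega> where "\<Omega> = (\<lambda>t. integral {0..t} \<omega>)"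
  have int: "\<omega> integrable_on {a..b}" for a b
    by (intro integrable_continuous_real continuous_on_subset[OF \<omega>(1)]) auto
  have mono: "\<Omega> s \<le> \<Omega> t" if "0 \<le> s" "s \<le> t" for s t unfolding \<Omega>_def
    by (rule integral_subset_le) (use that int \<omega>(2) in auto)
  show "integral {0..m} \<omega> \<le> schlicht_radius 0 f"
  proof (rule ccontr)
    assume "\<not> ?thesis"
    then have less: "\<rho> < \<Omega> m" by (simp add: \<rho>_def \<Omega>_def)
    have "continuous_on {0..m} \<Omega>" unfolding \<Omega>_def by (intro indefinite_integral_continuous_1 int)
    \<comment> \<open>A level strictly between \<rho> and \<Omega> m gives T < m. The branch domain
      then lies in \<open>cball 0 T\<close>, away from |z| = m, where neither \<omega> > 0 nor a
      nonzero determinant is assumed.\<close>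
    then obtain T where T: "0 \<le> T" "T \<le> m" "\<Omega> T = (\<rho> + \<Omega> m) / 2"
      using IVT'[of \<Omega> 0 "(\<rho> + \<Omega> m) / 2" m] less \<rho> m by (auto simp: \<Omega>_def)
    have Tm: "T < m" using T less by (cases "T = m") auto
    have UT: "U \<subseteq> cball 0 T"
    proof
      fix z assume z: "z \<in> U"
      then have fz: "f z \<in> ball (f 0) \<rho>" "?g (f z) = z"
        using bij by (auto simp: bij_betw_inv_into_left bij_betw_def simp flip: mem_ball)
      have "\<Omega> (norm z) \<le> norm (f z - f 0)"
        using integral_norm_inverse_branch_le[OF U(4) U(1-3) \<omega>(1,2) lower fz(1)] fz(2) by (simp add: \<Omega>_def)
      also have "\<dots> < \<rho>" using fz(1) by (simp add: dist_norm norm_minus_commute)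
      also have "\<rho> < \<Omega> T" using T(3) less by simp
      finally show "z \<in> cball 0 T" using mono[of T "norm z"] T(1) by force
    qed
    obtain t0 where t0: "t0 \<in> {0..T}" "\<And>t. t \<in> {0..T} \<Longrightarrow> \<omega> t0 \<le> \<omega> t"
      using continuous_attains_inf[of "{0..T}" \<omega>] T(1) continuous_on_subset[OF \<omega>(1)] by force
    define \<mu> where "\<mu> = \<omega> t0"
    have \<mu>: "\<mu> > 0" using \<omega>(3)[of t0] t0(1) Tm by (auto simp: \<mu>_def)
    \<comment> \<open>Written as a difference <= 0 so that it passes by continuity to the closure of
      U \<times> U, where it gives injectivity. The Lipschitz constant comes from the minimum \<mu>
      > 0 of \<omega> on [0, T].\<close>
    have lip: "norm (z - w) - inverse \<mu> * norm (f z - f w) \<le> 0" if zw: "z \<in> U" "w \<in> U" for z w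
    proof -
      have "\<forall>y\<in>ball (f 0) \<rho>. \<exists>B. (?g has_derivative (\<lambda>h. B *v h)) (at y within ball (f 0) \<rho>) \<and>
          onorm (\<lambda>h. B *v h) \<le> inverse \<mu>"
      proof
        fix y assume y: "y \<in> ball (f 0) \<rho>"
        obtain B where B: "(?g has_derivative (\<lambda>h. B *v h)) (at y)" "\<And>h. complex_jacobian f (?g y) *v (B *v h) = h"
          using biholomorphic_inverse_derivative[OF U(4) U(1) open_ball y] by metis
        have gy: "?g y \<in> U" using bij y by (auto simp: bij_betw_def inv_into_into)
        then have n: "norm (?g y) \<in> {0..T}" using UT by auto
        then have n1: "norm (?g y) < 1" using Tm m by auto
        have "norm (B *v h) \<le> inverse \<mu> * norm h" for h
        proof -
          have "\<mu> * norm (B *v h) \<le> \<omega> (norm (?g y)) * norm (B *v h)"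
            using t0(2)[OF n] by (intro mult_right_mono) (auto simp: \<mu>_def)
          also have "\<dots> \<le> norm h" using lower[OF n1, of "B *v h"] by (simp add: B(2))
          finally show ?thesis using \<mu> by (simp add: field_simps)
        qed
        then have "onorm (\<lambda>h. B *v h) \<le> inverse \<mu>" by (rule onorm_le)
        then show "\<exists>B. (?g has_derivative (\<lambda>h. B *v h)) (at y within ball (f 0) \<rho>) \<and>
          onorm (\<lambda>h. B *v h) \<le> inverse \<mu>" using B(1) has_derivative_at_withinI by blast
      qed
      then obtain B where B: "\<And>y. y \<in> ball (f 0) \<rho> \<Longrightarrow> (?g has_derivative (\<lambda>h. B y *v h)) (at y within ball (f 0) \<rho>)"
        "\<And>y. y \<in> ball (f 0) \<rho> \<Longrightarrow> onorm (\<lambda>h. B y *v h) \<le> inverse \<mu>" by metis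
      have "f z \<in> ball (f 0) \<rho>" "f w \<in> ball (f 0) \<rho>" using zw bij bij_betwE by blast+
      from differentiable_bound[OF convex_ball B this]
      have "norm (?g (f z) - ?g (f w)) \<le> inverse \<mu> * norm (f z - f w)" .
      then show ?thesis using zw bij by (simp add: bij_betw_inv_into_left)
    qed
    define K where "K = closure U"
    have KT: "K \<subseteq> cball 0 T" unfolding K_def using UT by (intro closure_minimal) auto
    have T1: "cball 0 T \<subseteq> ball (0 :: complex^'n) 1" using Tm m by auto
    have fK: "continuous_on K f"
      using holomorphic_map_on_imp_continuous_on[OF f] KT T1 continuous_on_subset by blast
    have "compact K" using KT unfolding K_def
      by (metis bounded_cball bounded_subset closed_closure compact_eq_bounded_closed)
    moreover have "inj_on f K"
    proof (rule inj_onI)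
      fix z w assume zw: "z \<in> K" "w \<in> K" "f z = f w"
      have cl: "closure (U \<times> U) = K \<times> K" by (simp add: K_def closure_Times)
      have "continuous_on (K \<times> K) (\<lambda>p. norm (fst p - snd p) - inverse \<mu> * norm (f (fst p) - f (snd p)))"
        by (intro continuous_intros continuous_on_compose2[OF fK]) auto
      then have "norm (fst (z, w) - snd (z, w)) - inverse \<mu> * norm (f (fst (z, w)) - f (snd (z, w))) \<le> 0"
        unfolding cl[symmetric] by (rule continuous_le_on_closure) (use zw lip in \<open>auto simp: cl\<close>)
      then show "z = w" using zw(3) by simp
    qed
    moreover have "cball (f 0) \<rho> \<subseteq> f ` K"
    proof -
      have "closed (f ` K)" using fK \<open>compact K\<close> by (intro compact_imp_closed compact_continuous_image)
      moreover have "ball (f 0) \<rho> \<subseteq> f ` K"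
        using bij image_mono[OF closure_subset[of U], of f] by (simp add: bij_betw_def K_def)
      ultimately show ?thesis using \<rho> closure_minimal[of "ball (f 0) \<rho>" "f ` K"] by simp
    qed
    moreover have "det (complex_jacobian f z) \<noteq> 0" if "z \<in> K" for z
      using that KT Tm det[of z] by fastforce
    moreover have "0 \<in> K" using U(2) closure_subset by (auto simp: K_def)
    ultimately obtain r where "r > \<rho>" "schlicht_ball f 0 r"
      using schlicht_ball_enlarge[OF f, of K 0 \<rho>] order_trans[OF KT T1] \<rho> by auto
    then show False using attained(2)[of r] by (simp add: \<rho>_def)
  qed
qed

section \<open>The estimate for Bloch mappings\<close>

text \<open>The derivative is (1 - t^2)^(b-1) (1 - (2b + 1) t^2), and the equation for a places it
  at the zero of the second factor.\<close>

lemma weighted_identity_strict_mono: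
  fixes a b x y :: real
  assumes b: "b > 0" and a: "(2 * b + 1) * a\<^sup>2 = 1" and xy: "0 \<le> x" "x < y" "y \<le> a"
  shows "x * (1 - x\<^sup>2) powr b < y * (1 - y\<^sup>2) powr b"
proof -
  have a1: "a\<^sup>2 < 1"
  proof -
    have "a\<^sup>2 > 0" using xy by simp
    then have "b * a\<^sup>2 > 0" using b by simp
    then show ?thesis using a by (simp add: algebra_simps)
  qed
  have "t\<^sup>2 \<le> a\<^sup>2" if "t \<in> {x..y}" for t using that xy by (intro power_mono) auto
  then have sq: "1 - t\<^sup>2 \<noteq> 0" if "t \<in> {x..y}" for t using that a1 by force
  show ?thesis
  proof (rule DERIV_pos_imp_increasing_open[OF xy(2)])
    fix t assume t: "x < t" "t < y"
    then have t0: "0 < t" "t < a" using xy by auto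
    then have t2: "t\<^sup>2 < a\<^sup>2" by (intro power_strict_mono) auto
    let ?w = "1 - t\<^sup>2"
    have w: "?w > 0" using t2 a1 by simp
    have "((\<lambda>x. x * (1 - x\<^sup>2) powr b) has_real_derivative ?w powr b + t * (b * ?w powr (b - 1) * (- (2 * t)))) (at t)"
      using w by (auto intro!: derivative_eq_intros simp: power2_eq_square)
    moreover have "?w powr b + t * (b * ?w powr (b - 1) * (- (2 * t))) = ?w powr (b - 1) * (1 - (2 * b + 1) * t\<^sup>2)"
    proof -
      have "?w powr b = ?w powr (b - 1) * ?w" using w powr_add[of ?w "b - 1" 1] by simp
      then show ?thesis by (simp only:) (simp add: algebra_simps power2_eq_square)
    qed
    moreover have "(2 * b + 1) * t\<^sup>2 < (2 * b + 1) * a\<^sup>2" using t2 b by (intro mult_strict_left_mono) auto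
    ultimately show "\<exists>D. ((\<lambda>x. x * (1 - x\<^sup>2) powr b) has_real_derivative D) (at t) \<and> 0 < D"
      using w a by (auto intro!: exI mult_pos_pos)
  next
    show "continuous_on {x..y} (\<lambda>x. x * (1 - x\<^sup>2) powr b)"
      using sq by (intro continuous_intros) auto
  qed
qed

section \<open>The function \<phi> and its root m\<close>

lemma bloch_a0_bounds:
  assumes "\<alpha> > 0"
  shows "0 < bloch_a0 \<alpha> n" "bloch_a0 \<alpha> n < 1" "(\<alpha> * (real n + 1) + 1) * (bloch_a0 \<alpha> n)\<^sup>2 = 1"
proof -
  have "\<alpha> * (real n + 1) > 0" using assms by simp
  then show "0 < bloch_a0 \<alpha> n" "bloch_a0 \<alpha> n < 1" "(\<alpha> * (real n + 1) + 1) * (bloch_a0 \<alpha> n)\<^sup>2 = 1"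
    by (simp_all add: bloch_a0_def power_divide)
qed

lemma bloch_phi_a0:
  assumes "\<alpha> > 0"
  shows "bloch_phi \<alpha> n (bloch_a0 \<alpha> n) = 1"
proof -
  define c where "c = \<alpha> * (real n + 1)"
  have c: "c > 0" using assms by (simp add: c_def)
  have a0: "bloch_a0 \<alpha> n = 1 / sqrt (c + 1)" by (simp only: bloch_a0_def c_def)
  have "1 - (bloch_a0 \<alpha> n)\<^sup>2 = c / (c + 1)"
    using c by (simp add: a0 power_divide field_simps)
  moreover have "(c / (c + 1)) powr (c / 2) * ((c + 1) / c) powr (c / 2) = 1"
    using c by (subst powr_mult[symmetric]) auto
  moreover have "bloch_a0 \<alpha> n * sqrt (c + 1) = 1" using c by (simp add: a0)
  moreover have "bloch_phi \<alpha> n (bloch_a0 \<alpha> n) = (bloch_a0 \<alpha> n * sqrt (c + 1)) *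
      ((1 - (bloch_a0 \<alpha> n)\<^sup>2) powr (c / 2) * ((c + 1) / c) powr (c / 2))"
    unfolding bloch_phi_def c_def[symmetric] by (simp only: mult_ac)
  ultimately show ?thesis by simp
qed

text \<open>The constants of \<open>bloch_phi\<close> cancel in the ratio to its value at
  \<open>bloch_a0\<close>, which is 1. Thus \<phi>(x) = x (1 - x^2)^b / (a (1 - a^2)^b) with a =
  a_0, the form required by the growth estimate on the disc.\<close>

lemma bloch_phi_scaled:
  "bloch_phi \<alpha> n x * (bloch_a0 \<alpha> n * (1 - (bloch_a0 \<alpha> n)\<^sup>2) powr (\<alpha> * (real n + 1) / 2)) =
    x * (1 - x\<^sup>2) powr (\<alpha> * (real n + 1) / 2) * bloch_phi \<alpha> n (bloch_a0 \<alpha> n)"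
  by (simp add: bloch_phi_def)

text \<open>Existence by the intermediate value theorem, uniqueness by strict monotonicity up to
  \<open>bloch_a0\<close>; only then does the \<open>THE\<close> in \<open>bloch_m\<close> denote
  the root.\<close>

lemma bloch_m_root:
  assumes \<alpha>: "\<alpha> > 0" and l: "0 < l" "l \<le> 1"
  shows "0 < bloch_m \<alpha> n l" "bloch_m \<alpha> n l \<le> bloch_a0 \<alpha> n" "bloch_phi \<alpha> n (bloch_m \<alpha> n l) = l"
proof -
  define a where "a = bloch_a0 \<alpha> n"
  define b where "b = \<alpha> * (real n + 1) / 2"
  have b: "b > 0" using \<alpha> by (simp add: b_def)
  have a: "0 < a" "a < 1" "(2 * b + 1) * a\<^sup>2 = 1"
    using bloch_a0_bounds[OF \<alpha>, of n] by (simp_all add: a_def b_def)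
  have a2: "1 - a\<^sup>2 > 0" using a by (simp add: power_less_one_iff)
  have phi: "bloch_phi \<alpha> n x * (a * (1 - a\<^sup>2) powr b) = x * (1 - x\<^sup>2) powr b" for x
    using bloch_phi_scaled[of \<alpha> n x] bloch_phi_a0[OF \<alpha>, of n] by (simp add: a_def b_def)
  have A: "a * (1 - a\<^sup>2) powr b > 0" using a a2 by simp
  have "1 - x\<^sup>2 \<noteq> 0" if "x \<in> {0..a}" for x
    using that a power_less_one_iff[of x 2] by simp
  then have "continuous_on {0..a} (\<lambda>x. x * (1 - x\<^sup>2) powr b)"
    by (intro continuous_intros) auto
  then obtain x where x: "0 \<le> x" "x \<le> a" "x * (1 - x\<^sup>2) powr b = l * (a * (1 - a\<^sup>2) powr b)"
    using IVT'[of "\<lambda>x. x * (1 - x\<^sup>2) powr b" 0 "l * (a * (1 - a\<^sup>2) powr b)" a] A a l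
    by (auto simp: mult_left_le_one_le)
  have "\<exists>!x. x \<in> {0..a} \<and> bloch_phi \<alpha> n x = l"
  proof (rule ex1I)
    show "x \<in> {0..a} \<and> bloch_phi \<alpha> n x = l" using x phi[of x] A by auto
    fix y assume y: "y \<in> {0..a} \<and> bloch_phi \<alpha> n y = l"
    then have "y * (1 - y\<^sup>2) powr b = x * (1 - x\<^sup>2) powr b" using phi[of y] x(3) by simp
    then show "y = x"
      using weighted_identity_strict_mono[OF b a(3), of x y] weighted_identity_strict_mono[OF b a(3), of y x] x y
      by (cases x y rule: linorder_cases) auto
  qed
  from theI'[OF this] have m: "bloch_m \<alpha> n l \<in> {0..a}" "bloch_phi \<alpha> n (bloch_m \<alpha> n l) = l"
    unfolding bloch_m_def a_def by auto
  moreover have "bloch_m \<alpha> n l \<noteq> 0"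
  proof
    assume "bloch_m \<alpha> n l = 0"
    then show False using m(2) l by (simp add: bloch_phi_def)
  qed
  ultimately show "0 < bloch_m \<alpha> n l" "bloch_m \<alpha> n l \<le> bloch_a0 \<alpha> n" "bloch_phi \<alpha> n (bloch_m \<alpha> n l) = l"
    by (auto simp: a_def)
qed

section \<open>Pointwise bounds for the Jacobian\<close>

lemma bloch_seminormD:
  assumes "bloch_seminorm \<alpha> f \<le> ereal K" "norm z < 1"
  shows "(1 - (norm z)\<^sup>2) powr \<alpha> * matrix_opnorm (complex_jacobian f z) \<le> K"
proof -
  have "ereal ((1 - (norm z)\<^sup>2) powr \<alpha> * matrix_opnorm (complex_jacobian f z)) \<le> bloch_seminorm \<alpha> f"
    unfolding bloch_seminorm_def by (rule SUP_upper) (use assms in simp)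
  then show ?thesis using assms(1) by (metis ereal_less_eq(3) order_trans)
qed

lemma bloch_det_seminormD:
  fixes f :: "complex^'n \<Rightarrow> complex^'n"
  assumes "bloch_det_seminorm \<alpha> f \<le> 1" "norm z < 1"
  shows "cmod (det (complex_jacobian f z)) * (1 - (norm z)\<^sup>2) powr (\<alpha> * (real CARD('n) + 1) / 2) \<le> 1"
proof -
  define N where "N = real CARD('n)"
  have N: "N > 0" by (simp add: N_def)
  define w where "w = 1 - (norm z)\<^sup>2"
  have w: "w > 0" using assms(2) by (simp add: w_def power_less_one_iff)
  define d where "d = cmod (det (complex_jacobian f z))"
  have "ereal (w powr (\<alpha> * (N + 1) / (2 * N)) * d powr (1 / N)) \<le> bloch_det_seminorm \<alpha> f"
    unfolding bloch_det_seminorm_def w_def d_def N_def by (rule SUP_upper) (use assms in simp)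
  from order_trans[OF this assms(1)]
  have "w powr (\<alpha> * (N + 1) / (2 * N)) * d powr (1 / N) \<le> 1" by (simp add: one_ereal_def)
  then have "(w powr (\<alpha> * (N + 1) / (2 * N)) * d powr (1 / N)) powr N \<le> 1"
    using N by (intro powr_le1) auto
  moreover have "(w powr (\<alpha> * (N + 1) / (2 * N)) * d powr (1 / N)) powr N = w powr (\<alpha> * (N + 1) / 2) * d"
    using N w by (simp add: powr_mult powr_powr d_def)
  ultimately show ?thesis by (simp add: w_def d_def N_def mult.commute)
qed

lemma det_jacobian_lower_bound:
  fixes f :: "complex^'n \<Rightarrow> complex^'n" and \<alpha> l :: real
  assumes \<alpha>: "\<alpha> > 0" and f: "holomorphic_map_on f (ball 0 1)" and sn: "bloch_det_seminorm \<alpha> f \<le> 1"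
    and l: "0 < l" "l \<le> 1" "det (complex_jacobian f 0) = complex_of_real l"
  defines "m \<equiv> bloch_m \<alpha> CARD('n) l"
  assumes z: "norm z \<le> m"
  shows "l / m * (m - norm z) / (1 - m * norm z) powr (\<alpha> * (real CARD('n) + 1) + 1) \<le>
    cmod (det (complex_jacobian f z))"
proof -
  define a where "a = bloch_a0 \<alpha> CARD('n)"
  define b where "b = \<alpha> * (real CARD('n) + 1) / 2"
  have b: "b > 0" using \<alpha> by (simp add: b_def)
  have a: "0 < a" "a < 1" "(2 * b + 1) * a\<^sup>2 = 1"
    using bloch_a0_bounds[OF \<alpha>, of "CARD('n)"] by (simp_all add: a_def b_def)
  have m: "0 < m" "m \<le> a" "bloch_phi \<alpha> CARD('n) m = l"
    using bloch_m_root[OF \<alpha> l(1,2), of "CARD('n)"] by (simp_all add: m_def a_def)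
  \<comment> \<open>u = z / |z|, or any unit vector if z = 0.\<close>
  obtain u where u: "norm u = 1" "z = of_real (norm z) *s u"
  proof (cases "z = 0")
    case True
    show ?thesis by (rule that[of "axis undefined 1"]) (simp_all add: True)
  next
    case False
    show ?thesis
    proof (rule that[of "of_real (1 / norm z) *s z"])
      show "norm (of_real (1 / norm z) *s z) = 1" using False
        by (simp add: norm_vector_smult_complex norm_divide)
      show "z = of_real (norm z) *s (of_real (1 / norm z) *s z)" using False
        by (simp add: vector_smult_assoc flip: of_real_mult)
    qed
  qed
  define g where "g = (\<lambda>\<zeta>. det (complex_jacobian f (0 + \<zeta> *s u)))"
  have "l / m * (m - norm z) / (1 - m * norm z) powr (2 * b + 1) \<le> norm (g (of_real (norm z)))"
  proof (rule weighted_growth_lower_bound[where a = a])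
    show "g holomorphic_on ball 0 1" unfolding g_def
      by (rule det_jacobian_holomorphic_on_line[OF f open_ball]) (simp add: norm_vector_smult_complex u)
    show "norm (g \<zeta>) * (1 - (norm \<zeta>)\<^sup>2) powr b \<le> 1" if "norm \<zeta> < 1" for \<zeta>
      using bloch_det_seminormD[OF sn, of "\<zeta> *s u"] that by (simp add: g_def b_def norm_vector_smult_complex u)
    show "x * (1 - x\<^sup>2) powr b \<le> m * (1 - m\<^sup>2) powr b" if "0 < x" "x \<le> m" for x
      using weighted_identity_strict_mono[OF b a(3), of x m] that m(2) by (cases "x = m") auto
    show "l * (a * (1 - a\<^sup>2) powr b) = m * (1 - m\<^sup>2) powr b"
      using bloch_phi_scaled[of \<alpha> "CARD('n)" m] bloch_phi_a0[OF \<alpha>, of "CARD('n)"] m(3) by (simp add: a_def b_def)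
  qed (use a b m l z in \<open>auto simp: g_def\<close>)
  then show ?thesis using u(2) by (simp add: g_def b_def)
qed

text \<open>The operator norm is at most K (1 - |z|^2)^(-\<alpha>); its (n - 1)-st power in
  \<open>det_le_norm_mult_opnorm_power\<close> is moved to the other side.\<close>

lemma jacobian_lower_bound:
  fixes f :: "complex^'n \<Rightarrow> complex^'n" and \<alpha> K :: real
  assumes K: "K > 0" and sn: "bloch_seminorm \<alpha> f \<le> ereal K" and z: "norm z < 1"
  shows "cmod (det (complex_jacobian f z)) * norm h * K powr (1 - real CARD('n)) *
    (1 - (norm z)\<^sup>2) powr (\<alpha> * (real CARD('n) - 1)) \<le> norm (complex_jacobian f z *v h)"
proof -
  define N where "N = real CARD('n) - 1"
  have N: "N = real (CARD('n) - 1)" by (simp add: N_def of_nat_diff Suc_leI)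
  define w where "w = 1 - (norm z)\<^sup>2"
  have w: "w > 0" using z by (simp add: w_def power_less_one_iff)
  define M where "M = K / w powr \<alpha>"
  have M: "M > 0" using K w by (simp add: M_def)
  let ?J = "complex_jacobian f z"
  have "matrix_opnorm ?J \<le> M"
    using bloch_seminormD[OF sn z] w by (simp add: M_def w_def[symmetric] field_simps)
  then have "matrix_opnorm ?J ^ (CARD('n) - 1) \<le> M ^ (CARD('n) - 1)"
    by (intro power_mono matrix_opnorm_nonneg)
  also have "\<dots> = M powr N" unfolding N using M by (rule powr_realpow[symmetric])
  finally have "norm (?J *v h) * matrix_opnorm ?J ^ (CARD('n) - 1) \<le> norm (?J *v h) * M powr N"
    by (intro mult_left_mono) auto
  then have le: "cmod (det ?J) * norm h \<le> norm (?J *v h) * M powr N"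
    using det_le_norm_mult_opnorm_power[of ?J h] by simp
  have "M powr N * (K powr (- N) * w powr (\<alpha> * N)) = 1"
    using K w by (simp add: M_def powr_divide powr_powr powr_minus field_simps)
  then have "norm (?J *v h) = norm (?J *v h) * M powr N * (K powr (- N) * w powr (\<alpha> * N))"
    by (simp add: mult.assoc)
  also have "\<dots> \<ge> cmod (det ?J) * norm h * (K powr (- N) * w powr (\<alpha> * N))"
    using le by (intro mult_right_mono) auto
  finally show ?thesis by (simp add: N_def w_def mult_ac)
qed

theorem theorem1p3:
  fixes f :: "complex^'n \<Rightarrow> complex^'n" and \<alpha> K l :: real
  assumes "\<alpha> > 0"
    and "f \<in> bloch_space \<alpha>"
    and "K \<ge> 1"
    and "bloch_seminorm \<alpha> f \<le> ereal K"
    and "bloch_det_seminorm \<alpha> f = 1"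
    and "0 < l" and "l \<le> 1"
    and "det (complex_jacobian f 0) = complex_of_real l"
  defines "n \<equiv> real CARD('n)"
    and "m \<equiv> bloch_m \<alpha> CARD('n) l"
  shows "schlicht_ball f 0 (schlicht_radius 0 f) \<and>
         ball (f 0) (schlicht_radius 0 f) \<subseteq> f ` ball 0 1 \<and>
         schlicht_radius 0 f \<ge>
           l * K powr (1 - n) / m *
             integral {0..m} (\<lambda>t. (1 - t\<^sup>2) powr (\<alpha> * (n - 1)) * (m - t) /
                                 (1 - m * t) powr (\<alpha> * (n + 1) + 1))"
proof -
  have f: "holomorphic_map_on f (ball 0 1)" using assms(2) by (simp add: bloch_space_def)
  have m: "0 < m" "m < 1"
    using bloch_m_root[OF assms(1,6,7), of "CARD('n)"] bloch_a0_bounds[OF assms(1), of "CARD('n)"]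
    by (simp_all add: m_def)
  define F where "F = (\<lambda>t. (1 - t\<^sup>2) powr (\<alpha> * (n - 1)) * (m - t) / (1 - m * t) powr (\<alpha> * (n + 1) + 1))"
  define c where "c = l * K powr (1 - n) / m"
  \<comment> \<open>Clamping the argument makes \<omega> continuous on the whole line. For t >= m it
    equals \<open>c * F m\<close>, which is 0, so the lower bound for f' is trivial where the
    determinant estimate gives nothing.\<close>
  define \<omega> where "\<omega> = (\<lambda>t. c * F (max 0 (min m t)))"
  have c: "c > 0" using assms(3,6) m by (simp add: c_def)
  have mt: "m * t < 1" "t\<^sup>2 < 1" if "0 \<le> t" "t \<le> m" for t
  proof -
    have "m * t \<le> m * 1" using that m by (intro mult_left_mono) auto
    then show "m * t < 1" using m by linarith
    show "t\<^sup>2 < 1" using that m by (simp add: power_less_one_iff)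
  qed
  have "1 - t\<^sup>2 \<noteq> 0" "1 - m * t \<noteq> 0" if "t \<in> {0..m}" for t using mt[of t] that by simp_all
  then have "continuous_on {0..m} F" unfolding F_def
    by (intro continuous_intros) auto
  moreover have "continuous_on UNIV (\<lambda>t. max 0 (min m t))" by (intro continuous_intros)
  ultimately have "continuous_on UNIV (\<lambda>t. F (max 0 (min m t)))"
    by (rule continuous_on_compose2) (use m in auto)
  then have cont: "continuous_on UNIV \<omega>" unfolding \<omega>_def by (rule continuous_on_mult_left)
  have det: "l / m * (m - norm z) / (1 - m * norm z) powr (\<alpha> * (n + 1) + 1) \<le> cmod (det (complex_jacobian f z))"
    if "norm z \<le> m" for z
    unfolding n_def m_def
    by (rule det_jacobian_lower_bound) (use assms f that in \<open>simp_all add: m_def\<close>)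
  have nonneg: "\<omega> t \<ge> 0" for t
    unfolding \<omega>_def F_def using c m by (intro mult_nonneg_nonneg divide_nonneg_nonneg) auto
  have pos: "\<omega> t > 0" if "0 \<le> t" "t < m" for t
    unfolding \<omega>_def F_def using c m that mt[of t] by (intro mult_pos_pos divide_pos_pos) auto
  have lower: "\<omega> (norm z) * norm h \<le> norm (complex_jacobian f z *v h)" if z: "norm z < 1" for z h
  proof (cases "norm z < m")
    case False
    then show ?thesis using m by (simp add: \<omega>_def F_def)
  next
    case True
    let ?k = "norm h * K powr (1 - n) * (1 - (norm z)\<^sup>2) powr (\<alpha> * (n - 1))"
    have "\<omega> (norm z) * norm h = l / m * (m - norm z) / (1 - m * norm z) powr (\<alpha> * (n + 1) + 1) * ?k"
      using True m by (simp add: \<omega>_def F_def c_def mult_ac)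
    also have "\<dots> \<le> cmod (det (complex_jacobian f z)) * ?k"
      using det[of z] True by (intro mult_right_mono) auto
    also have "\<dots> \<le> norm (complex_jacobian f z *v h)"
      using jacobian_lower_bound[OF _ assms(4) z, of h] assms(3) by (simp add: n_def mult_ac)
    finally show ?thesis .
  qed
  have nz: "det (complex_jacobian f z) \<noteq> 0" if z: "norm z < m" for z
  proof -
    have "0 < l / m * (m - norm z) / (1 - m * norm z) powr (\<alpha> * (n + 1) + 1)"
      using assms(6) m z mt[of "norm z"] by simp
    also have "\<dots> \<le> cmod (det (complex_jacobian f z))" using det z by simp
    finally show ?thesis by simp
  qed
  note R = schlicht_radius_ge_integral[OF f m(1) less_imp_le[OF m(2)] cont nonneg pos lower nz]
  have "integral {0..m} \<omega> = integral {0..m} (\<lambda>t. c * F t)"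
    by (rule integral_cong) (simp add: \<omega>_def)
  also have "\<dots> = c * integral {0..m} F" by (rule integral_mult_right)
  finally have "c * integral {0..m} F \<le> schlicht_radius 0 f" using R(2) by simp
  moreover have "ball (f 0) (schlicht_radius 0 f) \<subseteq> f ` ball 0 1"
    using R(1) unfolding schlicht_ball_def biholomorphic_onto_def bij_betw_def by blast
  ultimately show ?thesis using R(1) by (simp add: c_def F_def)
qed

end
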